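(* Let $1\le p<\infty$. Let $\mathcal{D}$ be a family of pairs $(a,\Omega)$ (the data) and let $\mathcal{G}^\dagger:(a,\Omega)\mapsto u$ be an operator on $\mathcal{D}$, such that: the domains $\Omega\subset\mathbb{R}^d$ are uniformly bounded, full-dimensional and have Lipschitz boundary; $a\in L_p(\Omega,\mathbb{R}^{d_a})$ and $u=\mathcal{G}^\dagger(a,\Omega)\in L_p(\Omega,\mathbb{R}^{d_u})$; and each $\Omega$ carries a density function $\rho(\cdot;\Omega)$ on $\Omega$ with $\inf_{\Omega,\,x\in\Omega}\rho(x;\Omega)=\rho_{\inf}>0$. Let $B\subset\mathbb{R}^d$ be a bounded hypercube containing all the domains $\Omega$. Let $\tilde a(x)=[a(x),x,\rho(x;\Omega)]\in\mathbb{R}^{d_a+d+1}$ for $x\in\Omega$, and define the extensions by zero $$\tilde a_B(x)=\begin{cases}\tilde a(x)&x\in\Omega\\0&x\in B\setminus\Omega\end{cases},\qquad u_B(x)=\begin{cases}u(x)&x\in\Omega\\0&x\in B\setminus\Omega\end{cases},$$ so that $\tilde a_B=[a_B,\,x\mathbf{1}_\Omega(x),\,\rho_B]$, and $\Omega$ and $\tilde a$ can be reconstructed from $\tilde a_B$ (the support of $\rho_B$ gives $\Omega$, and the restriction of $a_B$ to $\Omega$ gives $a$). Let $\mathcal{G}^\dagger_B: L_p(B,\mathbb{R}^{d_a+d+1})\to L_p(B,\mathbb{R}^{d_u})$ denote the extended operator, which satisfies $\mathcal{G}^\dagger_B(\tilde a_B)=u_B$, the extension by zero of $\mathcal{G}^\dagger(a,\Omega)$.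 Assume that $\mathcal{G}^\dagger_B$ is a continuous operator defined on a compact set $\mathcal{K}_B\subset L_p(B,\mathbb{R}^{d_a+d+1})$ of such extended inputs $\tilde a_B$, consisting of bounded functions with $\sup_{\tilde a_B\in\mathcal{K}_B}\|\tilde a_B\|_{L_\infty}<\infty$. Then for every $\epsilon>0$ there exists a Point Cloud Neural Operator $\mathcal{G}_\theta$ such that $$\sup_{\tilde a_B\in\mathcal{K}_B}\bigl\|\mathcal{G}^\dagger(a,\Omega)-\mathcal{G}_\theta(\tilde a)\bigr\|_{L_p(\Omega,\mathbb{R}^{d_u})}\le\epsilon .$$
   Context: A density function $\rho(\cdot;\Omega)$ on $\Omega$ is a nonnegative function on $\Omega$ with $\int_\Omega\rho(x;\Omega)\,\mathrm{d}x=1$. Point cloud neural layer (continuous level). It maps $f_{\rm in}:\Omega\to\mathbb{R}^{d_{\rm in}}$ to $f_{\rm out}:\Omega\to\mathbb{R}^{d_{\rm out}}$ by $$f_{\rm out}(x)=\sigma\Bigl(W^l f_{\rm in}(x)+b+\sum_{k}\int_\Omega e^{2\pi\mathrm{i}\frac{k}{L}\cdot(x-y)}W^v_k f_{\rm in}(y)\,\rho(y;\Omega)\,\mathrm{d}y+W^g\,\widetilde\nabla f_{\rm in}(x)\Bigr).$$ Here $W^l\in\mathbb{R}^{d_{\rm out}\times d_{\rm in}}$ and $b\in\mathbb{R}^{d_{\rm out}}$; $k$ runs over a finite set of frequencies in $\mathbb{Z}^d$ containing $0$ and symmetric under $k\mapsto-k$; $L\in\mathbb{R}^d_+$ and $k/L$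 is the componentwise quotient; $W^v_k\in\mathbb{C}^{d_{\rm out}\times d_{\rm in}}$ with $W^v_{-k}=\overline{W^v_k}$, so that the sum is real; $W^g\in\mathbb{R}^{d_{\rm out}\times(d\cdot d_{\rm in})}$; $\widetilde\nabla f_{\rm in}=\mathrm{SoftSign}(\nabla f_{\rm in})$ componentwise, with $\mathrm{SoftSign}(s)=s/(1+|s|)$, flattened to a vector of length $d\cdot d_{\rm in}$; and $\sigma$ is the GeLU activation $\sigma(s)=s\,\Phi(s)$ ($\Phi$ the standard normal distribution function), applied componentwise. If $W^g=0$ the gradient term is absent and no differentiability of $f_{\rm in}$ is required. Point Cloud Neural Operator. $\mathcal{G}_\theta$ is a composition of: a lifting layer $f(x)=\sigma(W^l\tilde a(x)+b)$ applied pointwise; finitely many point cloud neural layers (any number); and a projection layer $u(x)=W'\sigma(W^l f(x)+b)+b'$ applied pointwise, with $W'\in\mathbb{R}^{d_u\times m}$ and $b'\in\mathbb{R}^{d_u}$, where $m$ is the width of the hidden layer. All matrices, biases and length scales may differ from layer to layer and form the parameter $\theta$; depth, channel widths and the finite frequency set are arbitrary. Since layers with $W^v_k=0$ and $W^g=0$ are pointwise network layers, the lifting and projection parts may effectively be pointwise neural networks with several sublayers. $\mathcal{G}_\theta(\tilde a)$ denotes its output for the input $\tilde a$ on $\Omega$ with density $\rho(\cdot;\Omega)$. *)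

theory Defs
  imports "HOL-Probability.Probability"
begin

section \<open>The space \<open>L\<^sub>p(S)\<close>\<close>

definition Lp_fun :: "real \<Rightarrow> (real^'d) set \<Rightarrow> (real^'d \<Rightarrow> 'b::euclidean_space) set" where
  "Lp_fun p S = {f. f \<in> borel_measurable (lebesgue_on S) \<and>
                    integrable (lebesgue_on S) (\<lambda>x. norm (f x) powr p)}"

definition Lp_norm :: "real \<Rightarrow> (real^'d) set \<Rightarrow> (real^'d \<Rightarrow> 'b::euclidean_space) \<Rightarrow> real" where
  "Lp_norm p S f = (LINT x|lebesgue_on S. norm (f x) powr p) powr (1 / p)"

text \<open>Functions are total; the almost-everywhere quantifier over \<open>lebesgue_on S\<close> also identifies
  functions that differ only outside \<open>S\<close>.\<close>

definition Lp_class ::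
  "real \<Rightarrow> (real^'d) set \<Rightarrow> (real^'d \<Rightarrow> 'b::euclidean_space) \<Rightarrow> (real^'d \<Rightarrow> 'b) set" where
  "Lp_class p S f = {g \<in> Lp_fun p S. AE x in lebesgue_on S. g x = f x}"

definition Lp_space :: "real \<Rightarrow> (real^'d) set \<Rightarrow> (real^'d \<Rightarrow> 'b::euclidean_space) set set" where
  "Lp_space p S = Lp_class p S ` Lp_fun p S"

definition Lp_dist ::
  "real \<Rightarrow> (real^'d) set \<Rightarrow> (real^'d \<Rightarrow> 'b::euclidean_space) set \<Rightarrow> (real^'d \<Rightarrow> 'b) set \<Rightarrow> real" where
  "Lp_dist p S X Y = Lp_norm p S (\<lambda>x. (SOME f. f \<in> X) x - (SOME g. g \<in> Y) x)"

definition Lp_topology ::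
  "real \<Rightarrow> (real^'d) set \<Rightarrow> (real^'d \<Rightarrow> 'b::euclidean_space) set topology" where
  "Lp_topology p S = Metric_space.mtopology (Lp_space p S) (Lp_dist p S)"

text \<open>\<open>Metric_space.mtopology\<close> is meaningful only for an actual metric, so this is established
  here (for \<open>1 \<le> p\<close>), together with the independence of \<open>Lp_dist\<close> of representatives.\<close>

lemma Lp_fun_measurable: "f \<in> Lp_fun p S \<Longrightarrow> f \<in> borel_measurable (lebesgue_on S)"
  by (simp add: Lp_fun_def)

lemma Lp_fun_integrable: "f \<in> Lp_fun p S \<Longrightarrow> integrable (lebesgue_on S) (\<lambda>x. norm (f x) powr p)"
  by (simp add: Lp_fun_def)

lemma Lp_norm_nonneg: "0 \<le> Lp_norm p S f"
  by (simp add: Lp_norm_def)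

lemma convex_powr_nonneg:
  fixes x y t p :: real
  assumes "1 \<le> p" "0 \<le> x" "0 \<le> y" "0 \<le> t" "t \<le> 1"
  shows "((1 - t) * x + t * y) powr p \<le> (1 - t) * x powr p + t * y powr p"
proof -
  have scale: "(s * z) powr p \<le> s * z powr p" if "0 \<le> s" "s \<le> 1" "0 \<le> z" for s z :: real
  proof (cases "s = 0")
    case False
    then have "s powr p \<le> s powr 1"
      using that assms(1) by (intro powr_mono') auto
    with False that show ?thesis
      by (simp add: powr_mult mult_right_mono)
  qed auto
  consider "x = 0" | "y = 0" | "x > 0" "y > 0"
    using assms by linarith
  then show ?thesis
  proof cases
    case 1
    then show ?thesis using scale[of t y] assms by simp
  next
    case 2
    then show ?thesis using scale[of "1 - t" x] assms by simp
  next
    case 3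
    then show ?thesis
      using convex_onD[OF powr_convex[OF assms(1)], of t x y] assms by simp
  qed
qed

lemma Lp_fun_diff:
  assumes "1 \<le> p" "f \<in> Lp_fun p S" "g \<in> Lp_fun p S"
  shows "(\<lambda>x. f x - g x) \<in> Lp_fun p S"
proof -
  have [measurable]: "f \<in> borel_measurable (lebesgue_on S)" "g \<in> borel_measurable (lebesgue_on S)"
    using assms by (auto simp: Lp_fun_def)
  have bound: "norm (f x - g x) powr p \<le> 2 powr p * (norm (f x) powr p + norm (g x) powr p)" for x
  proof -
    have "norm (f x - g x) powr p \<le> (2 * max (norm (f x)) (norm (g x))) powr p"
      using assms(1) norm_triangle_ineq4[of "f x" "g x"] by (intro powr_mono2) auto
    also have "\<dots> = 2 powr p * max (norm (f x)) (norm (g x)) powr p"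
      by (simp add: powr_mult)
    also have "\<dots> \<le> 2 powr p * (norm (f x) powr p + norm (g x) powr p)"
      by (intro mult_left_mono) (auto simp: max_def)
    finally show ?thesis .
  qed
  have "integrable (lebesgue_on S) (\<lambda>x. 2 powr p * (norm (f x) powr p + norm (g x) powr p))"
    using assms by (intro integrable_mult_right Bochner_Integration.integrable_add Lp_fun_integrable)
  then have "integrable (lebesgue_on S) (\<lambda>x. norm (f x - g x) powr p)"
    by (rule Bochner_Integration.integrable_bound) (use bound in \<open>auto intro!: AE_I2\<close>)
  then show ?thesis by (simp add: Lp_fun_def)
qed

lemma Lp_norm_eq_0_iff:
  assumes "1 \<le> p" "f \<in> Lp_fun p S"
  shows "Lp_norm p S f = 0 \<longleftrightarrow> (AE x in lebesgue_on S. f x = 0)"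
  using integral_nonneg_eq_0_iff_AE[OF Lp_fun_integrable[OF assms(2)]] assms(1)
  by (simp add: Lp_norm_def)

lemma Lp_norm_powr:
  assumes "1 \<le> p"
  shows "Lp_norm p S f powr p = (LINT x|lebesgue_on S. norm (f x) powr p)"
  using assms by (simp add: Lp_norm_def powr_powr)

lemma Lp_norm_cong_AE:
  assumes "AE x in lebesgue_on S. f x = g x"
    and "f \<in> borel_measurable (lebesgue_on S)" "g \<in> borel_measurable (lebesgue_on S)"
  shows "Lp_norm p S f = Lp_norm p S g"
proof -
  have [measurable]: "f \<in> borel_measurable (lebesgue_on S)" "g \<in> borel_measurable (lebesgue_on S)"
    using assms by auto
  have "(LINT x|lebesgue_on S. norm (f x) powr p) = (LINT x|lebesgue_on S. norm (g x) powr p)"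
    by (rule integral_cong_AE) (use assms(1) in auto)
  then show ?thesis by (simp add: Lp_norm_def)
qed

lemma Lp_norm_triangle:
  assumes p: "1 \<le> p" and fg: "f \<in> Lp_fun p S" "g \<in> Lp_fun p S" and h: "h \<in> Lp_fun p S"
    and le: "\<And>x. norm (h x) \<le> norm (f x) + norm (g x)"
  shows "Lp_norm p S h \<le> Lp_norm p S f + Lp_norm p S g"
proof -
  have main: "Lp_norm p S h \<le> A + C" if AC: "Lp_norm p S f < A" "Lp_norm p S g < C" for A C
  proof -
    have pos: "0 < A" "0 < C"
      using AC Lp_norm_nonneg[of p S f] Lp_norm_nonneg[of p S g] by linarith+
    define t where "t = C / (A + C)"
    have t: "0 \<le> t" "t \<le> 1" "1 - t = A / (A + C)"
      using pos by (auto simp: t_def field_simps)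
    have pt: "norm (h x) powr p \<le> (A + C) powr p *
      ((1 - t) * (norm (f x) powr p / A powr p) + t * (norm (g x) powr p / C powr p))" for x
    proof -
      have "norm (h x) \<le> (A + C) * ((1 - t) * (norm (f x) / A) + t * (norm (g x) / C))"
      proof -
        have "(A + C) * ((1 - t) * (norm (f x) / A) + t * (norm (g x) / C)) =
            ((A + C) * (1 - t)) * (norm (f x) / A) + ((A + C) * t) * (norm (g x) / C)"
          by (simp only: distrib_left mult.assoc)
        also have "(A + C) * (1 - t) = A" using pos unfolding t(3) by simp
        also have "(A + C) * t = C" using pos by (simp add: t_def)
        finally show ?thesis using le[of x] pos by simp
      qed
      then have "norm (h x) powr p \<le> ((A + C) * ((1 - t) * (norm (f x) / A) + t * (norm (g x) / C))) powr p"
        using p by (intro powr_mono2) auto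
      also have "\<dots> = (A + C) powr p * ((1 - t) * (norm (f x) / A) + t * (norm (g x) / C)) powr p"
        by (rule powr_mult)
      also have "\<dots> \<le> (A + C) powr p * ((1 - t) * (norm (f x) / A) powr p + t * (norm (g x) / C) powr p)"
        using p pos t by (intro mult_left_mono convex_powr_nonneg) auto
      finally show ?thesis using pos by (simp add: powr_divide)
    qed
    have le1: "(LINT x|lebesgue_on S. norm (f x) powr p) / A powr p \<le> 1"
    proof -
      have "Lp_norm p S f powr p \<le> A powr p"
        using AC p Lp_norm_nonneg[of p S f] by (intro powr_mono2) auto
      then show ?thesis using pos p by (simp add: Lp_norm_powr)
    qed
    have le2: "(LINT x|lebesgue_on S. norm (g x) powr p) / C powr p \<le> 1"
    proof -
      have "Lp_norm p S g powr p \<le> C powr p"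
        using AC p Lp_norm_nonneg[of p S g] by (intro powr_mono2) auto
      then show ?thesis using pos p by (simp add: Lp_norm_powr)
    qed
    have int: "integrable (lebesgue_on S) (\<lambda>x. norm (f x) powr p)"
      "integrable (lebesgue_on S) (\<lambda>x. norm (g x) powr p)"
      using fg by (auto intro: Lp_fun_integrable)
    have "(LINT x|lebesgue_on S. norm (h x) powr p) \<le> (LINT x|lebesgue_on S. (A + C) powr p *
      ((1 - t) * (norm (f x) powr p / A powr p) + t * (norm (g x) powr p / C powr p)))"
      by (rule integral_mono) (use int h pt in \<open>auto intro: Lp_fun_integrable\<close>)
    also have "\<dots> = (A + C) powr p * ((1 - t) * ((LINT x|lebesgue_on S. norm (f x) powr p) / A powr p)
        + t * ((LINT x|lebesgue_on S. norm (g x) powr p) / C powr p))"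
      using int by simp
    also have "\<dots> \<le> (A + C) powr p * ((1 - t) * 1 + t * 1)"
      using t(1,2) le1 le2 by (intro mult_left_mono add_mono) auto
    finally have "Lp_norm p S h powr p \<le> (A + C) powr p"
      by (simp add: Lp_norm_powr[OF p])
    then show ?thesis
      using p pos powr_less_mono2[of p "A + C" "Lp_norm p S h"] by (cases "Lp_norm p S h \<le> A + C") auto
  qed
  show ?thesis
  proof (rule field_le_epsilon)
    fix e :: real assume "0 < e"
    then show "Lp_norm p S h \<le> Lp_norm p S f + Lp_norm p S g + e"
      using main[of "Lp_norm p S f + e / 2" "Lp_norm p S g + e / 2"] by simp
  qed
qed

lemma Lp_class_self: "f \<in> Lp_fun p S \<Longrightarrow> f \<in> Lp_class p S f"
  by (simp add: Lp_class_def)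

lemma Lp_class_eqI:
  assumes "AE x in lebesgue_on S. f x = g x"
  shows "Lp_class p S f = Lp_class p S g"
proof -
  have "(AE x in lebesgue_on S. h x = f x) \<longleftrightarrow> (AE x in lebesgue_on S. h x = g x)" for h
    using assms by (auto elim: eventually_elim2)
  then show ?thesis by (simp add: Lp_class_def)
qed

lemma Lp_dist_class:
  assumes f: "f \<in> Lp_fun p S" and g: "g \<in> Lp_fun p S"
  shows "Lp_dist p S (Lp_class p S f) (Lp_class p S g) = Lp_norm p S (\<lambda>x. f x - g x)"
proof -
  define f' where "f' = (SOME h. h \<in> Lp_class p S f)"
  define g' where "g' = (SOME h. h \<in> Lp_class p S g)"
  have f': "f' \<in> Lp_class p S f" and g': "g' \<in> Lp_class p S g"
    using someI[of "\<lambda>h. h \<in> Lp_class p S f", OF Lp_class_self[OF f]]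
      someI[of "\<lambda>h. h \<in> Lp_class p S g", OF Lp_class_self[OF g]]
    by (simp_all add: f'_def g'_def)
  have [measurable]: "f \<in> borel_measurable (lebesgue_on S)" "g \<in> borel_measurable (lebesgue_on S)"
    "f' \<in> borel_measurable (lebesgue_on S)" "g' \<in> borel_measurable (lebesgue_on S)"
    using f g f' g' by (auto simp: Lp_fun_def Lp_class_def)
  have "AE x in lebesgue_on S. f' x = f x" "AE x in lebesgue_on S. g' x = g x"
    using f' g' by (auto simp: Lp_class_def)
  then have "AE x in lebesgue_on S. f' x - g' x = f x - g x"
    by eventually_elim simp
  then have "Lp_norm p S (\<lambda>x. f' x - g' x) = Lp_norm p S (\<lambda>x. f x - g x)"
    by (rule Lp_norm_cong_AE) measurable
  then show ?thesis by (simp add: Lp_dist_def f'_def g'_def)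
qed

lemma Metric_space_Lp:
  assumes p: "1 \<le> p"
  shows "Metric_space (Lp_space p S :: (real^'d \<Rightarrow> 'b::euclidean_space) set set) (Lp_dist p S)"
proof
  fix X Y :: "(real^'d \<Rightarrow> 'b) set"
  show "0 \<le> Lp_dist p S X Y"
    by (simp add: Lp_dist_def Lp_norm_nonneg)
  show "Lp_dist p S X Y = Lp_dist p S Y X"
    by (simp add: Lp_dist_def Lp_norm_def norm_minus_commute)
next
  fix X Y :: "(real^'d \<Rightarrow> 'b) set"
  assume "X \<in> Lp_space p S" "Y \<in> Lp_space p S"
  then obtain f g where f: "f \<in> Lp_fun p S" "X = Lp_class p S f"
    and g: "g \<in> Lp_fun p S" "Y = Lp_class p S g"
    by (auto simp: Lp_space_def)
  have "Lp_dist p S X Y = 0 \<longleftrightarrow> (AE x in lebesgue_on S. f x - g x = 0)"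
    unfolding f g Lp_dist_class[OF f(1) g(1)]
    by (rule Lp_norm_eq_0_iff[OF p Lp_fun_diff[OF p f(1) g(1)]])
  also have "\<dots> \<longleftrightarrow> X = Y"
  proof
    assume "AE x in lebesgue_on S. f x - g x = 0"
    then show "X = Y"
      unfolding f g by (intro Lp_class_eqI) simp
  next
    assume "X = Y"
    then have "f \<in> Lp_class p S g"
      using Lp_class_self[OF f(1)] f g by simp
    then show "AE x in lebesgue_on S. f x - g x = 0"
      by (simp add: Lp_class_def)
  qed
  finally show "Lp_dist p S X Y = 0 \<longleftrightarrow> X = Y" .
next
  fix X Y Z :: "(real^'d \<Rightarrow> 'b) set"
  assume "X \<in> Lp_space p S" "Y \<in> Lp_space p S" "Z \<in> Lp_space p S"
  then obtain f g h where f: "f \<in> Lp_fun p S" "X = Lp_class p S f"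
    and g: "g \<in> Lp_fun p S" "Y = Lp_class p S g" and h: "h \<in> Lp_fun p S" "Z = Lp_class p S h"
    by (auto simp: Lp_space_def)
  have "norm (f x - h x) \<le> norm (f x - g x) + norm (g x - h x)" for x
    using norm_triangle_ineq[of "f x - g x" "g x - h x"] by simp
  then show "Lp_dist p S X Z \<le> Lp_dist p S X Y + Lp_dist p S Y Z"
    unfolding f(2) g(2) h(2) Lp_dist_class[OF f(1) g(1)] Lp_dist_class[OF g(1) h(1)]
      Lp_dist_class[OF f(1) h(1)]
    by (intro Lp_norm_triangle[OF p] Lp_fun_diff[OF p] f(1) g(1) h(1))
qed


section \<open>Domains, densities and extended inputs\<close>

text \<open>Near each boundary point, \<open>S\<close> lies above the graph of a Lipschitz function over the
  hyperplane orthogonal to a unit vector \<open>e\<close>. Which points of the graph itself belong to \<open>S\<close> is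
  left open, so that open and closed domains are both covered.\<close>

definition lipschitz_boundary :: "(real^'d) set \<Rightarrow> bool" where
  "lipschitz_boundary S \<longleftrightarrow>
     (\<forall>z \<in> frontier S. \<exists>r > 0. \<exists>e \<gamma> C. norm e = 1 \<and> C-lipschitz_on {y. y \<bullet> e = 0} \<gamma> \<and>
        (\<forall>x \<in> ball z r.
           (x \<bullet> e > \<gamma> (x - (x \<bullet> e) *\<^sub>R e) \<longrightarrow> x \<in> S) \<and>
           (x \<bullet> e < \<gamma> (x - (x \<bullet> e) *\<^sub>R e) \<longrightarrow> x \<notin> S)))"

definition density_on :: "(real^'d) set \<Rightarrow> (real^'d \<Rightarrow> real) \<Rightarrow> bool" where
  "density_on S \<rho> \<longleftrightarrow> (\<forall>x \<in> S. 0 \<le> \<rho> x) \<and> integrable (lebesgue_on S) \<rho> \<and>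
     (LINT x|lebesgue_on S. \<rho> x) = 1"

text \<open>\<open>\<real>^(d\<^sub>a + d + 1)\<close> is the vector type indexed by \<open>'a + 'd + unit\<close>.\<close>

definition tilde_input ::
  "(real^'d \<Rightarrow> real^'a) \<Rightarrow> (real^'d \<Rightarrow> real) \<Rightarrow> real^'d \<Rightarrow> real^('a + 'd + unit)" where
  "tilde_input a \<rho> x =
     (\<chi> i. case i of Inl j \<Rightarrow> a x $ j | Inr (Inl j) \<Rightarrow> x $ j | Inr (Inr _) \<Rightarrow> \<rho> x)"

definition zero_ext :: "'x set \<Rightarrow> ('x \<Rightarrow> 'b::zero) \<Rightarrow> 'x \<Rightarrow> 'b" where
  "zero_ext S f x = (if x \<in> S then f x else 0)"


section \<open>Point cloud neural operators\<close>

definition gelu :: "real \<Rightarrow> real" where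
  "gelu s = s * cdf std_normal_distribution s"

definition soft_sign :: "real \<Rightarrow> real" where
  "soft_sign s = s / (1 + \<bar>s\<bar>)"

text \<open>Channel vectors of varying width \<open>n\<close> are functions on \<open>nat\<close> of which only the entries below
  \<open>n\<close> are ever used; the same holds for the rows and columns of matrices. The entry of \<open>W\<^sup>g\<close> that
  multiplies \<open>\<partial>\<^sub>s f\<^sub>j\<close> in row \<open>i\<close> is \<open>grad_wt l i j s\<close>.\<close>

record 'd pcno_layer =
  in_width :: nat
  out_width :: nat
  lin_wt :: "nat \<Rightarrow> nat \<Rightarrow> real"
  bias :: "nat \<Rightarrow> real"
  lengths :: "real^'d"
  int_wt :: "int^'d \<Rightarrow> nat \<Rightarrow> nat \<Rightarrow> complex"
  grad_wt :: "nat \<Rightarrow> nat \<Rightarrow> 'd \<Rightarrow> real"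

record ('i, 'd, 'u) pcno =
  lift_width :: nat
  lift_wt :: "nat \<Rightarrow> 'i \<Rightarrow> real"
  lift_bias :: "nat \<Rightarrow> real"
  freqs :: "(int^'d) set"
  layers :: "'d pcno_layer list"
  proj_in_width :: nat
  proj_width :: nat
  proj_wt :: "nat \<Rightarrow> nat \<Rightarrow> real"
  proj_bias :: "nat \<Rightarrow> real"
  out_wt :: "'u \<Rightarrow> nat \<Rightarrow> real"
  out_bias :: "real^'u"

definition int_kernel_term ::
  "('d::finite) pcno_layer \<Rightarrow> int^'d \<Rightarrow> (real^'d \<Rightarrow> nat \<Rightarrow> real) \<Rightarrow> (real^'d \<Rightarrow> real) \<Rightarrow>
   real^'d \<Rightarrow> nat \<Rightarrow> real^'d \<Rightarrow> complex" where
  "int_kernel_term l k f \<rho> x i y =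
     exp (2 * complex_of_real pi * \<i> *
            complex_of_real (\<Sum>s\<in>UNIV. of_int (k $ s) / lengths l $ s * (x $ s - y $ s))) *
     (\<Sum>j<in_width l. int_wt l k i j * complex_of_real (f y j)) * complex_of_real (\<rho> y)"

definition partial_deriv :: "(real^'d) set \<Rightarrow> (real^'d \<Rightarrow> real) \<Rightarrow> real^'d \<Rightarrow> 'd \<Rightarrow> real" where
  "partial_deriv S g x s = frechet_derivative g (at x within S) (axis s 1)"

text \<open>The sum over the frequencies is real by the conjugation symmetry of the weights, so \<open>Re\<close> merely
  converts its type.\<close>

definition layer_map ::
  "(int^'d) set \<Rightarrow> (real^'d) set \<Rightarrow> (real^'d \<Rightarrow> real) \<Rightarrow> ('d::finite) pcno_layer \<Rightarrow>
   (real^'d \<Rightarrow> nat \<Rightarrow> real) \<Rightarrow> real^'d \<Rightarrow> nat \<Rightarrow> real" where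
  "layer_map F S \<rho> l f x i =
     gelu ((\<Sum>j<in_width l. lin_wt l i j * f x j) + bias l i
       + Re (\<Sum>k\<in>F. LINT y|lebesgue_on S. int_kernel_term l k f \<rho> x i y)
       + (\<Sum>j<in_width l. \<Sum>s\<in>UNIV.
            grad_wt l i j s * soft_sign (partial_deriv S (\<lambda>z. f z j) x s)))"

text \<open>The library's integral and derivative are total, with arbitrary values where they do not exist.
  The following predicate says that those occurring in a layer do exist; differentiability is
  required only if the gradient weights do not vanish.\<close>

definition layer_defined ::
  "(int^'d) set \<Rightarrow> (real^'d) set \<Rightarrow> (real^'d \<Rightarrow> real) \<Rightarrow> ('d::finite) pcno_layer \<Rightarrow>
   (real^'d \<Rightarrow> nat \<Rightarrow> real) \<Rightarrow> bool" where
  "layer_defined F S \<rho> l f \<longleftrightarrow>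
     (\<forall>k\<in>F. \<forall>x\<in>S. \<forall>i<out_width l. integrable (lebesgue_on S) (int_kernel_term l k f \<rho> x i)) \<and>
     ((\<exists>i<out_width l. \<exists>j<in_width l. \<exists>s. grad_wt l i j s \<noteq> 0) \<longrightarrow>
        (\<forall>j<in_width l. (\<lambda>z. f z j) differentiable_on S))"

primrec layers_map ::
  "(int^'d) set \<Rightarrow> (real^'d) set \<Rightarrow> (real^'d \<Rightarrow> real) \<Rightarrow> ('d::finite) pcno_layer list \<Rightarrow>
   (real^'d \<Rightarrow> nat \<Rightarrow> real) \<Rightarrow> real^'d \<Rightarrow> nat \<Rightarrow> real" where
  "layers_map F S \<rho> [] f = f"
| "layers_map F S \<rho> (l # ls) f = layers_map F S \<rho> ls (layer_map F S \<rho> l f)"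

primrec layers_defined ::
  "(int^'d) set \<Rightarrow> (real^'d) set \<Rightarrow> (real^'d \<Rightarrow> real) \<Rightarrow> ('d::finite) pcno_layer list \<Rightarrow>
   (real^'d \<Rightarrow> nat \<Rightarrow> real) \<Rightarrow> bool" where
  "layers_defined F S \<rho> [] f \<longleftrightarrow> True"
| "layers_defined F S \<rho> (l # ls) f \<longleftrightarrow>
     layer_defined F S \<rho> l f \<and> layers_defined F S \<rho> ls (layer_map F S \<rho> l f)"

definition lift_map ::
  "('i::finite, 'd::finite, 'u::finite) pcno \<Rightarrow> (real^'d \<Rightarrow> real^'i) \<Rightarrow> real^'d \<Rightarrow> nat \<Rightarrow> real" where
  "lift_map \<theta> v x i = gelu ((\<Sum>j\<in>UNIV. lift_wt \<theta> i j * v x $ j) + lift_bias \<theta> i)"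

definition proj_map ::
  "('i, 'd::finite, 'u::finite) pcno \<Rightarrow> (real^'d \<Rightarrow> nat \<Rightarrow> real) \<Rightarrow> real^'d \<Rightarrow> real^'u" where
  "proj_map \<theta> f x = (\<chi> r. (\<Sum>i<proj_width \<theta>. out_wt \<theta> r i *
      gelu ((\<Sum>j<proj_in_width \<theta>. proj_wt \<theta> i j * f x j) + proj_bias \<theta> i)) + out_bias \<theta> $ r)"

definition pcno_map ::
  "('i::finite, 'd::finite, 'u::finite) pcno \<Rightarrow> (real^'d) set \<Rightarrow> (real^'d \<Rightarrow> real) \<Rightarrow>
   (real^'d \<Rightarrow> real^'i) \<Rightarrow> real^'d \<Rightarrow> real^'u" where
  "pcno_map \<theta> S \<rho> v = proj_map \<theta> (layers_map (freqs \<theta>) S \<rho> (layers \<theta>) (lift_map \<theta> v))"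

definition pcno_defined ::
  "('i::finite, 'd::finite, 'u::finite) pcno \<Rightarrow> (real^'d) set \<Rightarrow> (real^'d \<Rightarrow> real) \<Rightarrow>
   (real^'d \<Rightarrow> real^'i) \<Rightarrow> bool" where
  "pcno_defined \<theta> S \<rho> v \<longleftrightarrow> layers_defined (freqs \<theta>) S \<rho> (layers \<theta>) (lift_map \<theta> v)"

definition layer_ok :: "(int^'d) set \<Rightarrow> ('d::finite) pcno_layer \<Rightarrow> bool" where
  "layer_ok F l \<longleftrightarrow> 0 < in_width l \<and> 0 < out_width l \<and> (\<forall>s. 0 < lengths l $ s) \<and>
     (\<forall>k\<in>F. \<forall>i<out_width l. \<forall>j<in_width l. int_wt l (- k) i j = cnj (int_wt l k i j))"

primrec width_chain :: "nat \<Rightarrow> ('d::finite) pcno_layer list \<Rightarrow> nat \<Rightarrow> bool" where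
  "width_chain n [] m \<longleftrightarrow> n = m"
| "width_chain n (l # ls) m \<longleftrightarrow> in_width l = n \<and> width_chain (out_width l) ls m"

definition pcno_ok :: "('i, 'd::finite, 'u::finite) pcno \<Rightarrow> bool" where
  "pcno_ok \<theta> \<longleftrightarrow>
     finite (freqs \<theta>) \<and> 0 \<in> freqs \<theta> \<and> (\<forall>k \<in> freqs \<theta>. - k \<in> freqs \<theta>) \<and>
     (\<forall>l \<in> set (layers \<theta>). layer_ok (freqs \<theta>) l) \<and>
     0 < lift_width \<theta> \<and> 0 < proj_in_width \<theta> \<and> 0 < proj_width \<theta> \<and>
     width_chain (lift_width \<theta>) (layers \<theta>) (proj_in_width \<theta>)"

end

theory Submission
  imports Defs
begin

text \<open>
  A single integral layer that uses only the frequency \<open>k = 0\<close> suffices. With \<open>v\<close> the input on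
  \<open>\<Omega>\<close>, such an operator has the form
  \<open>u\<^sub>r(x) = \<Sum>\<^sub>i c\<^sub>r\<^sub>i gelu (l\<^sub>i(x) + \<Phi>\<^sub>i + \<beta>\<^sub>i)\<close> with \<open>\<Phi>\<^sub>i = \<integral>\<^sub>\<Omega> h\<^sub>i(v(y)) \<rho>(y) dy\<close>,
  where \<open>l\<^sub>i\<close> is linear and \<open>h\<^sub>i\<close> is a shallow GeLU network: the lifting layer holds the neurons of
  all \<open>h\<^sub>i\<close>, the integral layer forms \<open>\<Phi>\<^sub>i\<close>, adds \<open>l\<^sub>i(x)\<close> and applies the outer GeLU. Identity
  maps, which carry \<open>x\<close> through the lifting layer and the result through the projection layer, are
  exact because \<open>gelu t - gelu (- t) = t\<close> (\<open>gelu_diff\<close>). This is \<open>pcno_realization\<close>.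

  It remains to see that these expressions are rich enough.

  \<^item> The target, a continuous map from the compact set \<open>K\<^sub>B\<close> into \<open>L\<^sub>p\<close>, is uniformly close in \<open>L\<^sub>p\<close> to
    a finite sum \<open>\<Sum>\<^sub>w c\<^sub>w(X) w(x)\<close> with continuous coefficients and continuous functions \<open>w\<close>, by a
    partition of unity and the density of continuous functions
    (\<open>Lp_valued_map_approximation\<close>). So it is enough to approximate a continuous real function on the
    compact space \<open>K\<^sub>B \<times> B\<close> uniformly.

  \<^item> On a compact space whose points are separated by a set \<open>A\<close> of continuous functions, the functions
    \<open>exp t\<close> with \<open>t\<close> in the span of \<open>A\<close> span an algebra, since \<open>exp s * exp t = exp (s + t)\<close>. By
    Stone-Weierstrass it is dense, and on a bounded interval \<open>exp\<close> is a uniform limit of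
    combinations of shifted and scaled GeLUs. Hence the GeLU ridge functions \<open>gelu (t + \<beta>)\<close> span a dense
    set (\<open>gelu_ridge_dense\<close>). With \<open>A\<close> consisting of the coordinates of \<open>x\<close> and the functionals
    \<open>\<Phi>\<^sub>h(v) = \<integral> h(v) \<rho>\<close>, these are exactly the expressions above.

  \<^item> The functionals \<open>\<Phi>\<^sub>h\<close> are continuous on \<open>K\<^sub>B\<close> because its elements are uniformly bounded
    (\<open>superposition_integral_continuous\<close>), and they separate its points
    (\<open>extended_input_determined\<close>). The latter is where the position and the density among the channels
    of the input matter: testing with functions of the position channel recovers the density \<open>\<rho>\<close>, hence
    \<open>\<Omega>\<close>, and testing with such a function times a channel of \<open>a\<close> recovers \<open>a \<rho>\<close>, hence \<open>a\<close>.
\<close>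

section \<open>Linear combinations of real functions\<close>

inductive_set lin_comb :: "('x \<Rightarrow> real) set \<Rightarrow> ('x \<Rightarrow> real) set" for A where
  zero: "(\<lambda>x. 0) \<in> lin_comb A"
| step: "g \<in> A \<Longrightarrow> f \<in> lin_comb A \<Longrightarrow> (\<lambda>x. c * g x + f x) \<in> lin_comb A"

lemma lin_comb_base: "g \<in> A \<Longrightarrow> g \<in> lin_comb A"
  using lin_comb.step[OF _ lin_comb.zero, of g A 1] by simp

lemma lin_comb_add:
  assumes "f \<in> lin_comb A" "g \<in> lin_comb A"
  shows "(\<lambda>x. f x + g x) \<in> lin_comb A"
  using assms(1)
proof induction
  case zero
  then show ?case using assms(2) by simp
next
  case (step h f c)
  then show ?case
    using lin_comb.step[of h A "\<lambda>x. f x + g x" c] by (simp add: add.assoc)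
qed

lemma lin_comb_scale:
  assumes "f \<in> lin_comb A"
  shows "(\<lambda>x. c * f x) \<in> lin_comb A"
  using assms
proof induction
  case zero
  then show ?case by (simp add: lin_comb.zero)
next
  case (step h f d)
  then show ?case
    using lin_comb.step[of h A "\<lambda>x. c * f x" "c * d"] by (simp add: algebra_simps)
qed

lemma lin_comb_mult:
  assumes A: "\<And>f g. f \<in> A \<Longrightarrow> g \<in> A \<Longrightarrow> (\<lambda>x. f x * g x) \<in> A"
    and f: "f \<in> lin_comb A" and g: "g \<in> lin_comb A"
  shows "(\<lambda>x. f x * g x) \<in> lin_comb A"
proof -
  have *: "(\<lambda>x. h x * g x) \<in> lin_comb A" if h: "h \<in> A" for h
    using g
  proof induction
    case zero
    then show ?case by (simp add: lin_comb.zero)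
  next
    case (step k g c)
    then show ?case
      using lin_comb.step[of "\<lambda>x. h x * k x" A "\<lambda>x. h x * g x" c] A[OF h]
      by (simp add: algebra_simps)
  qed
  show ?thesis
    using f
  proof induction
    case zero
    then show ?case by (simp add: lin_comb.zero)
  next
    case (step h f c)
    then show ?case
      using lin_comb_add[OF lin_comb_scale[OF *[of h], of c]] by (simp add: algebra_simps)
  qed
qed

text \<open>
  Used both to substitute inner functions into a network and, with \<open>t\<close> the identity, to pass to a
  larger set of generators.
\<close>

lemma lin_comb_compose:
  assumes "f \<in> lin_comb A" "\<And>g. g \<in> A \<Longrightarrow> (\<lambda>x. g (t x)) \<in> A'"
  shows "(\<lambda>x. f (t x)) \<in> lin_comb A'"
  using assms(1)
  by induction (auto intro: lin_comb.zero lin_comb.step[OF assms(2)])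

text \<open>
  Approximability of generators is inherited by combinations, because finitely many coefficients
  magnify the error only by a fixed factor. This is what allows one activation function to be
  replaced by another.
\<close>

lemma lin_comb_approx:
  assumes "f \<in> lin_comb A" "e > 0"
    and approx: "\<And>g e. g \<in> A \<Longrightarrow> e > 0 \<Longrightarrow> \<exists>h\<in>lin_comb A'. \<forall>x\<in>S. \<bar>g x - h x\<bar> < e"
  shows "\<exists>h\<in>lin_comb A'. \<forall>x\<in>S. \<bar>f x - h x\<bar> < (e::real)"
  using assms(1,2)
proof (induction arbitrary: e)
  case zero
  then show ?case by (intro bexI[of _ "\<lambda>x. 0"] lin_comb.zero) auto
next
  case (step g f c)
  define d where "d = e / 2 / (\<bar>c\<bar> + 1)"
  have d: "d > 0" using step.prems by (simp add: d_def)
  obtain h1 where h1: "h1 \<in> lin_comb A'" "\<And>x. x \<in> S \<Longrightarrow> \<bar>g x - h1 x\<bar> < d"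
    using approx[OF step.hyps(1) d] by blast
  obtain h2 where h2: "h2 \<in> lin_comb A'" "\<And>x. x \<in> S \<Longrightarrow> \<bar>f x - h2 x\<bar> < e / 2"
    using step.IH[of "e / 2"] step.prems by auto
  have "\<bar>(c * g x + f x) - (c * h1 x + h2 x)\<bar> < e" if "x \<in> S" for x
  proof -
    have "\<bar>(c * g x + f x) - (c * h1 x + h2 x)\<bar> \<le> \<bar>c * (g x - h1 x)\<bar> + \<bar>f x - h2 x\<bar>"
      unfolding right_diff_distrib by linarith
    also have "\<bar>c * (g x - h1 x)\<bar> \<le> (\<bar>c\<bar> + 1) * d"
      unfolding abs_mult using h1(2)[OF that] by (intro mult_mono) auto
    also have "(\<bar>c\<bar> + 1) * d = e / 2" using step.prems abs_ge_zero[of c] by (simp add: d_def divide_simps)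
    finally show ?thesis using h2(2)[OF that] by linarith
  qed
  then show ?case
    by (intro bexI[of _ "\<lambda>x. c * h1 x + h2 x"]) (auto intro: lin_comb_add[OF lin_comb_scale[OF h1(1)] h2(1)])
qed

lemma continuous_map_lin_comb:
  assumes "f \<in> lin_comb A" "\<And>g. g \<in> A \<Longrightarrow> continuous_map X euclideanreal g"
  shows "continuous_map X euclideanreal f"
  using assms(1)
proof induction
  case (step g f c)
  from assms(2)[OF step.hyps(1)] step.IH show ?case
    by (intro continuous_map_add continuous_map_real_mult_left)
qed simp

lemma sum_lessThan_add:
  fixes f :: "nat \<Rightarrow> 'a::comm_monoid_add"
  shows "(\<Sum>j<m + n. f j) = (\<Sum>j<m. f j) + (\<Sum>j<n. f (m + j))"
  by (induction n) (auto simp: add.assoc)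

lemma lin_comb_representation:
  assumes "f \<in> lin_comb A"
  shows "\<exists>N g c. (\<forall>j<N::nat. g j \<in> A) \<and> f = (\<lambda>x. \<Sum>j<N. c j * g j x)"
  using assms
proof induction
  case zero
  show ?case by (rule exI[of _ 0]) auto
next
  case (step h f d)
  then obtain N g c where *: "\<forall>j<N::nat. g j \<in> A" "f = (\<lambda>x. \<Sum>j<N. c j * g j x)"
    by auto
  show ?case
    by (intro exI[of _ "Suc N"] exI[of _ "g(N := h)"] exI[of _ "c(N := d)"])
      (use * step.hyps in \<open>auto simp: less_Suc_eq\<close>)
qed

text \<open>
  A layer has one list of neurons that all outputs share. So finitely many combinations have to be
  written over the same generators; their lists are concatenated and the coefficients padded with
  zeros. The list is made nonempty because layers have positive width.
\<close>

lemma lin_comb_common_representation: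
  assumes "finite I" "A \<noteq> {}" "\<And>i. i \<in> I \<Longrightarrow> f i \<in> lin_comb A"
  shows "\<exists>N g c. 0 < N \<and> (\<forall>j<N::nat. g j \<in> A) \<and> (\<forall>i\<in>I. f i = (\<lambda>x. \<Sum>j<N. c i j * g j x))"
  using assms(1,3)
proof induction
  case empty
  obtain g where "g \<in> A" using assms(2) by blast
  then show ?case by (intro exI[of _ 1] exI[of _ "\<lambda>_. g"]) auto
next
  case (insert i I)
  then have "\<exists>N g c. 0 < N \<and> (\<forall>j<N::nat. g j \<in> A) \<and> (\<forall>i\<in>I. f i = (\<lambda>x. \<Sum>j<N. c i j * g j x))"
    by blast
  then obtain N g c where "0 < N \<and> (\<forall>j<N::nat. g j \<in> A) \<and> (\<forall>i\<in>I. f i = (\<lambda>x. \<Sum>j<N. c i j * g j x))"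
    by (elim exE)
  then have 1: "0 < N" "\<And>j. j < N \<Longrightarrow> g j \<in> A"
    "\<And>i. i \<in> I \<Longrightarrow> f i = (\<lambda>x. \<Sum>j<N. c i j * g j x)"
    by simp_all
  obtain n h d where "(\<forall>j<n::nat. h j \<in> A) \<and> f i = (\<lambda>x. \<Sum>j<n. d j * h j x)"
    using lin_comb_representation[OF insert.prems[OF insertI1]] by (elim exE)
  then have 2: "\<And>j. j < n \<Longrightarrow> h j \<in> A" "f i = (\<lambda>x. \<Sum>j<n. d j * h j x)"
    by simp_all
  define g' where "g' j = (if j < N then g j else h (j - N))" for j
  define c' where "c' k j = (if k = i then if j < N then 0 else d (j - N)
                             else if j < N then c k j else 0)" for k j
  have "f k = (\<lambda>x. \<Sum>j<N + n. c' k j * g' j x)" if "k \<in> insert i I" for k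
    using that insert.hyps 1(3)[of k] 2(2)
    by (cases "k = i") (auto simp: sum_lessThan_add c'_def g'_def)
  moreover have "g' j \<in> A" if "j < N + n" for j
    using that 1(2)[of j] 2(1)[of "j - N"] by (auto simp: g'_def)
  ultimately show ?case
    using 1(1) by (intro exI[of _ "N + n"] exI[of _ g'] exI[of _ c']) auto
qed

section \<open>The Stone-Weierstrass theorem for abstract compact spaces\<close>

text \<open>
  \<open>K\<^sub>B\<close> is not a subset of a topological type: its topology is that of a metric on classes. It is moved
  into a Hausdorff type by evaluation, where a point goes to the family of the values at it of the
  functions of the algebra. For this, function types have to be Hausdorff in the
  product topology, whatever the index type.
\<close>

lemma open_coordinate_vimage: "open U \<Longrightarrow> open ((\<lambda>f :: 'a \<Rightarrow> 'b::topological_space. f i) -` U)"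
  by (rule open_vimage[OF _ continuous_on_product_coordinates])

instance "fun" :: (type, t0_space) t0_space
proof
  fix x y :: "'a \<Rightarrow> 'b"
  assume "x \<noteq> y"
  then obtain i where i: "x i \<noteq> y i" by blast
  from t0_space_class.t0_space[OF i] obtain U where "open U" "\<not> (x i \<in> U \<longleftrightarrow> y i \<in> U)" by blast
  then show "\<exists>U. open U \<and> \<not> (x \<in> U \<longleftrightarrow> y \<in> U)"
    by (intro exI[of _ "(\<lambda>f :: 'a \<Rightarrow> 'b. f i) -` U"]) (auto intro: open_coordinate_vimage)
qed

instance "fun" :: (type, t1_space) t1_space
proof
  fix x y :: "'a \<Rightarrow> 'b"
  assume "x \<noteq> y"
  then obtain i where i: "x i \<noteq> y i" by blast
  from t1_space_class.t1_space[OF i] obtain U where "open U" "x i \<in> U" "y i \<notin> U" by blast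
  then show "\<exists>U. open U \<and> x \<in> U \<and> y \<notin> U"
    by (intro exI[of _ "(\<lambda>f :: 'a \<Rightarrow> 'b. f i) -` U"]) (auto intro: open_coordinate_vimage)
qed

instance "fun" :: (type, t2_space) t2_space
proof
  fix x y :: "'a \<Rightarrow> 'b"
  assume "x \<noteq> y"
  then obtain i where i: "x i \<noteq> y i" by blast
  from hausdorff[OF i] obtain U V where "open U" "open V" "x i \<in> U" "y i \<in> V" "U \<inter> V = {}"
    by blast
  then show "\<exists>U V. open U \<and> open V \<and> x \<in> U \<and> y \<in> V \<and> U \<inter> V = {}"
    by (intro exI[of _ "(\<lambda>f :: 'a \<Rightarrow> 'b. f i) -` U"] exI[of _ "(\<lambda>f :: 'a \<Rightarrow> 'b. f i) -` V"])
      (auto intro: open_coordinate_vimage)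
qed

theorem Stone_Weierstrass_compact_space:
  fixes R :: "('x \<Rightarrow> real) set"
  assumes X: "compact_space X"
    and cont: "\<And>f. f \<in> R \<Longrightarrow> continuous_map X euclideanreal f"
    and add: "\<And>f g. f \<in> R \<Longrightarrow> g \<in> R \<Longrightarrow> (\<lambda>x. f x + g x) \<in> R"
    and mult: "\<And>f g. f \<in> R \<Longrightarrow> g \<in> R \<Longrightarrow> (\<lambda>x. f x * g x) \<in> R"
    and const: "\<And>c. (\<lambda>_. c) \<in> R"
    and sep: "\<And>x y. x \<in> topspace X \<Longrightarrow> y \<in> topspace X \<Longrightarrow> x \<noteq> y \<Longrightarrow> \<exists>f\<in>R. f x \<noteq> f y"
    and f: "continuous_map X euclideanreal f" and e: "e > 0"
  shows "\<exists>g\<in>R. \<forall>x\<in>topspace X. \<bar>f x - g x\<bar> < e"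
proof -
  define ev :: "'x \<Rightarrow> ('x \<Rightarrow> real) \<Rightarrow> real" where "ev x t = (if t \<in> R then t x else 0)" for x t
  define S where "S = ev ` topspace X"
  have "continuous_map X (product_topology (\<lambda>_. euclidean) UNIV) ev"
    by (rule continuous_map_coordinatewise_then_product) (auto simp: ev_def cont)
  then have ev: "continuous_map X euclidean ev"
    by (simp only: euclidean_product_topology)
  have S: "compact S"
    using image_compactin[OF X[unfolded compact_space_def] ev] by (simp add: S_def)
  have inj: "inj_on ev (topspace X)"
  proof (rule inj_onI, rule ccontr)
    fix x y assume xy: "x \<in> topspace X" "y \<in> topspace X" "ev x = ev y" "x \<noteq> y"
    then obtain t where "t \<in> R" "t x \<noteq> t y" using sep by blast
    with xy(3) show False by (metis ev_def)
  qed
  \<comment> \<open>Evaluation is injective and closed, hence an embedding, so \<open>f\<close> stays continuous on the image.\<close>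
  define f' where "f' = f \<circ> inv_into (topspace X) ev"
  have f': "f' (ev x) = f x" if "x \<in> topspace X" for x
    using that inj by (simp add: f'_def inv_into_f_f)
  have "Hausdorff_space (product_topology (\<lambda>_::'x \<Rightarrow> real. euclideanreal) UNIV)"
    by (simp add: Hausdorff_space_product_topology)
  then have hausdorff: "Hausdorff_space (euclidean :: (('x \<Rightarrow> real) \<Rightarrow> real) topology)"
    by (simp only: euclidean_product_topology)
  have q: "quotient_map X (top_of_set S) ev"
  proof (rule continuous_closed_imp_quotient_map)
    show "continuous_map X (top_of_set S) ev"
      using ev by (simp add: continuous_map_in_subtopology S_def)
    then show "closed_map X (top_of_set S) ev"
      by (rule T1_Spaces.continuous_imp_closed_map[OF _ X Hausdorff_space_subtopology[OF hausdorff]])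
  qed (simp add: S_def)
  have "continuous_map X euclideanreal (f' \<circ> ev)"
    using f by (rule continuous_map_eq) (simp add: f')
  with q have "continuous_map (top_of_set S) euclideanreal f'"
    using continuous_compose_quotient_map by blast
  then have contf': "continuous_on S f'" by simp
  \<comment> \<open>Sums and products of coordinate projections are again such projections only on the image of
    \<open>ev\<close>, so the algebra consists of the functions that agree there with a member of \<open>R\<close>.\<close>
  define P where "P F \<longleftrightarrow> (\<exists>t\<in>R. \<forall>x\<in>topspace X. F (ev x) = t x)" for F
  have "\<exists>F. P F \<and> (\<forall>\<psi>\<in>S. \<bar>f' \<psi> - F \<psi>\<bar> < e)"
  proof (rule Stone_Weierstrass_HOL[OF S])
    show "P (\<lambda>x. c)" for c
      unfolding P_def by (rule bexI[OF _ const[of c]]) simp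
    show "continuous_on S F" if "P F" for F
    proof -
      obtain t where t: "t \<in> R" "\<And>x. x \<in> topspace X \<Longrightarrow> F (ev x) = t x"
        using \<open>P F\<close> by (auto simp: P_def)
      have "continuous_on S (\<lambda>\<psi>. \<psi> t)"
        by (rule continuous_on_subset[OF continuous_on_product_coordinates subset_UNIV])
      then show ?thesis
        by (rule continuous_on_eq) (use t in \<open>auto simp: S_def ev_def\<close>)
    qed
    show "P (\<lambda>x. F x + G x)" if "P F \<and> P G" for F G
      using that unfolding P_def by (auto intro: add)
    show "P (\<lambda>x. F x * G x)" if "P F \<and> P G" for F G
      using that unfolding P_def by (auto intro: mult)
    show "\<exists>F. P F \<and> F \<phi> \<noteq> F \<psi>" if ne: "\<phi> \<in> S \<and> \<psi> \<in> S \<and> \<phi> \<noteq> \<psi>" for \<phi> \<psi>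
    proof -
      obtain x y where xy: "x \<in> topspace X" "y \<in> topspace X" "\<phi> = ev x" "\<psi> = ev y"
        using ne by (auto simp: S_def)
      then obtain t where "t \<in> R" "t x \<noteq> t y"
        using ne sep by blast
      then show ?thesis
        unfolding P_def xy by (intro exI[of _ "\<lambda>\<psi>. \<psi> t"]) (auto simp: ev_def)
    qed
  qed (use contf' e in auto)
  then obtain F t where F: "\<And>\<psi>. \<psi> \<in> S \<Longrightarrow> \<bar>f' \<psi> - F \<psi>\<bar> < e"
    "t \<in> R" "\<And>x. x \<in> topspace X \<Longrightarrow> F (ev x) = t x"
    by (auto simp: P_def)
  have "\<bar>f x - t x\<bar> < e" if "x \<in> topspace X" for x
    using F(1)[of "ev x"] F(3)[OF that] f'[OF that] that by (auto simp: S_def)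
  with F(2) show ?thesis by blast
qed

section \<open>The GeLU activation\<close>

interpretation std_normal: real_distribution std_normal_distribution
  by (rule real_dist_normal_dist)

lemma std_normal_singleton: "measure std_normal_distribution {x} = 0"
proof -
  have "emeasure std_normal_distribution {x} = (\<integral>\<^sup>+y. ennreal (std_normal_density y) * indicator {x} y \<partial>lborel)"
    by (subst emeasure_density) auto
  also have "\<dots> = 0"
    by (subst nn_integral_0_iff_AE) (auto intro!: eventually_mono[OF AE_lborel_singleton[of x]])
  finally show ?thesis by (simp add: measure_def)
qed

text \<open>
  The density is even, so the lower tail at \<open>- t\<close> is the upper tail at \<open>t\<close>; a single point has no mass.
\<close>

lemma std_normal_cdf_minus:
  "cdf std_normal_distribution (- t) = 1 - cdf std_normal_distribution t"
proof -
  have "emeasure std_normal_distribution {..- t} =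
      (\<integral>\<^sup>+y. ennreal (std_normal_density y) * indicator {..- t} y \<partial>lborel)"
    by (subst emeasure_density) auto
  also have "\<dots> = (\<integral>\<^sup>+y. ennreal (std_normal_density y) * indicator {..- t} y \<partial>distr lborel borel uminus)"
    by (simp add: lborel_distr_uminus)
  also have "\<dots> = (\<integral>\<^sup>+y. ennreal (std_normal_density (- y)) * indicator {..- t} (- y) \<partial>lborel)"
    by (subst nn_integral_distr) auto
  also have "\<dots> = (\<integral>\<^sup>+y. ennreal (std_normal_density y) * indicator {t..} y \<partial>lborel)"
    by (intro nn_integral_cong) (auto simp: std_normal_density_def indicator_def)
  also have "\<dots> = emeasure std_normal_distribution {t..}"
    by (subst emeasure_density) auto
  finally have "cdf std_normal_distribution (- t) = measure std_normal_distribution {t..}"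
    by (simp add: cdf_def measure_def)
  also have "{t..} = {t} \<union> (UNIV - {..t})" by auto
  also have "measure std_normal_distribution \<dots> =
      measure std_normal_distribution {t} + measure std_normal_distribution (UNIV - {..t})"
    by (intro std_normal.finite_measure_Union) auto
  also have "\<dots> = 1 - cdf std_normal_distribution t"
    using std_normal.prob_compl[of "{..t}"] by (simp add: std_normal_singleton cdf_def)
  finally show ?thesis .
qed

text \<open>
  The symmetry of the normal distribution makes the identity a combination of two neurons, so
  a value passes through a layer without error.
\<close>

lemma gelu_diff: "gelu t - gelu (- t) = t"
  by (simp add: gelu_def std_normal_cdf_minus algebra_simps)

lemma continuous_on_gelu: "continuous_on S gelu"
proof -
  have "isCont (cdf std_normal_distribution) x" for x
    by (simp add: std_normal.isCont_cdf std_normal_singleton)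
  then show ?thesis
    unfolding gelu_def by (intro continuous_intros continuous_at_imp_continuous_on) auto
qed

text \<open>
  The difference is \<open>\<bar>s\<bar> \<Phi>(- \<bar>s\<bar>)\<close>, a tail estimate: on the event \<open>x \<le> - t\<close> one has
  \<open>t \<le> \<bar>x\<bar> \<le> (1 + x\<^sup>2) / 2\<close>, and the right side has mean \<open>1\<close>. By scaling, \<open>gelu (\<lambda> s) / \<lambda>\<close> is within
  \<open>1 / \<lambda>\<close> of the rectifier.
\<close>

lemma gelu_relu: "\<bar>max 0 s - gelu s\<bar> \<le> 1"
proof -
  let ?N = std_normal_distribution
  have *: "t * cdf ?N (- t) \<le> 1" if "0 \<le> t" for t
  proof -
    have sq: "(LINT x|?N. x\<^sup>2) = 1"
      using std_normal_distribution_even_moments(1)[of 1] by (simp add: fact_numeral)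
    have int: "integrable ?N (\<lambda>x. (1 + x\<^sup>2) / 2)"
      by (intro integrable_divide Bochner_Integration.integrable_add
          integrable_std_normal_distribution_moment) auto
    have "t * cdf ?N (- t) = (LINT x|?N. t * indicator {..- t} x)"
      by (simp add: cdf_def)
    also have "\<dots> \<le> (LINT x|?N. (1 + x\<^sup>2) / 2)"
    proof (rule integral_mono[OF _ int])
      show "integrable ?N (\<lambda>x. t * indicator {..- t} x)"
        by (intro integrable_mult_right std_normal.integrable_const_bound[where B=1]) (auto simp: indicator_def)
      fix x :: real
      have "2 * \<bar>x\<bar> \<le> 1 + x\<^sup>2"
        using zero_le_power2[of "\<bar>x\<bar> - 1"] by (simp add: power2_eq_square algebra_simps)
      then show "t * indicator {..- t} x \<le> (1 + x\<^sup>2) / 2"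
        using that by (auto simp: indicator_def)
    qed
    also have "\<dots> = ((LINT x|?N. 1) + (LINT x|?N. x\<^sup>2)) / 2"
      using integrable_std_normal_distribution_moment[of 2]
      by (subst Bochner_Integration.integral_add[symmetric]) auto
    also have "\<dots> = 1"
      using sq std_normal.prob_space by simp
    finally show ?thesis .
  qed
  have cdf0: "0 \<le> cdf ?N t" for t by (rule std_normal.cdf_nonneg)
  show ?thesis
  proof (cases "0 \<le> s")
    case True
    then show ?thesis
      using *[of s] cdf0[of "- s"] mult_nonneg_nonneg[of s "cdf ?N (- s)"]
      by (simp add: gelu_def std_normal_cdf_minus algebra_simps)
  next
    case False
    then show ?thesis
      using *[of "- s"] mult_nonneg_nonneg[of "- s" "cdf ?N s"] cdf0[of s]
      by (simp add: gelu_def)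
  qed
qed

text \<open>
  The approximant is the piecewise linear interpolant of \<open>f\<close> on a grid finer than its modulus of
  continuity. It is built from left to right: it stays constant beyond the current node, and the next
  piece is added as a ramp \<open>m (t - u)\<^sup>+ - m (t - v)\<^sup>+\<close>, which vanishes to the left of \<open>u\<close> and is
  constant to the right of \<open>v\<close>. On the piece, the error at \<open>t\<close> is a convex combination of
  \<open>f t - f u\<close> and \<open>f t - f v\<close>.
\<close>

lemma relu_dense_interval:
  fixes f :: "real \<Rightarrow> real"
  assumes f: "continuous_on {a..b} f" and e: "e > 0" and "a \<le> b"
  shows "\<exists>g\<in>lin_comb {\<lambda>t. max 0 (w * t + d) |w d. True}. \<forall>t\<in>{a..b}. \<bar>f t - g t\<bar> < e"
proof -
  let ?A = "{\<lambda>t. max 0 (w * t + d) |w d :: real. True}"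
  have "uniformly_continuous_on {a..b} f"
    using f by (intro compact_uniformly_continuous) auto
  then obtain \<delta> where \<delta>: "\<delta> > 0"
    "\<And>x y. x \<in> {a..b} \<Longrightarrow> y \<in> {a..b} \<Longrightarrow> \<bar>x - y\<bar> < \<delta> \<Longrightarrow> \<bar>f x - f y\<bar> < e"
    using e unfolding uniformly_continuous_on_def dist_real_def by metis
  define h where "h = \<delta> / 2"
  have h: "0 < h" "h < \<delta>" using \<delta> by (auto simp: h_def)
  \<comment> \<open>Truncation at \<open>b\<close>: the last step may be shorter, and later nodes all equal \<open>b\<close>.\<close>
  define tn where "tn k = min b (a + real k * h)" for k
  have tn: "tn k \<in> {a..b}" "tn k \<le> tn (Suc k)" "tn (Suc k) - tn k < \<delta>" for k
    using h \<open>a \<le> b\<close> by (auto simp: tn_def min_def algebra_simps)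
  have "\<exists>g\<in>lin_comb ?A. (\<forall>t\<ge>tn k. g t = f (tn k)) \<and> (\<forall>t\<in>{a..tn k}. \<bar>f t - g t\<bar> < e)" for k
  proof (induction k)
    case 0
    have "(\<lambda>t. max 0 (0 * t + 1)) \<in> ?A" by blast
    from lin_comb_scale[OF lin_comb_base[OF this], of "f a"]
    have "(\<lambda>t. f a) \<in> lin_comb ?A" by simp
    then show ?case
      using \<open>a \<le> b\<close> e by (intro bexI[of _ "\<lambda>t. f a"]) (auto simp: tn_def)
  next
    case (Suc k)
    then obtain g where g: "g \<in> lin_comb ?A" "\<And>t. t \<ge> tn k \<Longrightarrow> g t = f (tn k)"
      "\<And>t. t \<in> {a..tn k} \<Longrightarrow> \<bar>f t - g t\<bar> < e" by blast
    define u v where "u = tn k" and "v = tn (Suc k)"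
    have uv: "u \<in> {a..b}" "v \<in> {a..b}" "u \<le> v" "v - u < \<delta>"
      using tn by (auto simp: u_def v_def)
    show ?case
    proof (cases "u = v")
      case True
      then show ?thesis using g by (intro bexI[of _ g]) (auto simp: u_def v_def)
    next
      case False
      then have "u < v" using uv by simp
      define m where "m = (f v - f u) / (v - u)"
      define g' where "g' t = g t + (m * max 0 (t - u) + (- m) * max 0 (t - v))" for t
      have atom: "(\<lambda>t. c * max 0 (t - d)) \<in> lin_comb ?A" for c d :: real
      proof -
        have "(\<lambda>t. max 0 (1 * t + (- d))) \<in> ?A" by blast
        from lin_comb_scale[OF lin_comb_base[OF this]] show ?thesis by simp
      qed
      have "g' \<in> lin_comb ?A"
        unfolding g'_def by (intro lin_comb_add g atom)
      moreover have "g' t = f v" if "t \<ge> v" for t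
      proof -
        have "g' t = f u + m * (v - u)"
          using that \<open>u < v\<close> g(2)[of t] by (simp add: g'_def u_def[symmetric] algebra_simps)
        then show ?thesis using \<open>u < v\<close> by (simp add: m_def)
      qed
      moreover have "\<bar>f t - g' t\<bar> < e" if t: "t \<in> {a..v}" for t
      proof (cases "t \<le> u")
        case True
        then show ?thesis
          using g(3)[of t] t \<open>u < v\<close> by (simp add: g'_def u_def[symmetric])
      next
        case False
        define l where "l = (t - u) / (v - u)"
        have l: "0 \<le> l" "l \<le> 1" using False t \<open>u < v\<close> by (auto simp: l_def field_simps)
        have "g' t = f u + m * (t - u)"
          using False t g(2)[of t] by (simp add: g'_def u_def[symmetric])
        also have "m * (t - u) = l * (f v - f u)" by (simp add: m_def l_def)
        finally have "f t - g' t = (1 - l) * (f t - f u) + l * (f t - f v)"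
          by (simp add: algebra_simps)
        moreover have "\<bar>f t - f u\<bar> < e" "\<bar>f t - f v\<bar> < e"
          using uv t False by (auto intro!: \<delta>(2))
        ultimately show ?thesis
          using convex_bound_lt[of "\<bar>f t - f u\<bar>" e "\<bar>f t - f v\<bar>" "1 - l" l] l
            abs_triangle_ineq[of "(1 - l) * (f t - f u)" "l * (f t - f v)"]
          by (simp add: abs_mult)
      qed
      ultimately show ?thesis unfolding v_def by blast
    qed
  qed note ind = this
  obtain n :: nat where "(b - a) / h < real n" using reals_Archimedean2 by blast
  then have "tn n = b" using h by (simp add: tn_def field_simps)
  with ind[of n] show ?thesis by auto
qed

lemma gelu_dense_interval:
  fixes f :: "real \<Rightarrow> real"
  assumes f: "continuous_on {a..b} f" and e: "e > 0" and "a \<le> b"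
  shows "\<exists>g\<in>lin_comb {\<lambda>t. gelu (w * t + d) |w d. True}. \<forall>t\<in>{a..b}. \<bar>f t - g t\<bar> < e"
proof -
  obtain g where g: "g \<in> lin_comb {\<lambda>t. max 0 (w * t + d) |w d. True}"
    "\<And>t. t \<in> {a..b} \<Longrightarrow> \<bar>f t - g t\<bar> < e / 2"
    using relu_dense_interval[OF f _ \<open>a \<le> b\<close>, of "e / 2"] e by auto
  have "\<exists>h\<in>lin_comb {\<lambda>t. gelu (w * t + d) |w d. True}. \<forall>t\<in>{a..b}. \<bar>r t - h t\<bar> < e'"
    if r: "r \<in> {\<lambda>t. max 0 (w * t + d) |w d. True}" and e': "e' > 0" for r e'
  proof -
    obtain w d where r: "r = (\<lambda>t. max 0 (w * t + d))" using r by blast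
    define l where "l = 2 / e'"
    have l: "l > 0" "1 / l < e'" using e' by (auto simp: l_def)
    have "(\<lambda>t. gelu ((l * w) * t + l * d)) \<in> {\<lambda>t. gelu (w * t + d) |w d. True}" by blast
    then have "(\<lambda>t. 1 / l * gelu ((l * w) * t + l * d)) \<in> lin_comb {\<lambda>t. gelu (w * t + d) |w d. True}"
      by (intro lin_comb_scale lin_comb_base)
    moreover have "\<bar>r t - 1 / l * gelu ((l * w) * t + l * d)\<bar> < e'" for t
    proof -
      have "max 0 (l * (w * t + d)) = l * max 0 (w * t + d)"
        using l by (simp add: max_mult_distrib_left)
      then have "r t - 1 / l * gelu ((l * w) * t + l * d) =
          1 / l * (max 0 (l * (w * t + d)) - gelu (l * (w * t + d)))"
        using l by (simp add: r algebra_simps)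
      also have "\<bar>\<dots>\<bar> \<le> 1 / l * 1"
        unfolding abs_mult using l gelu_relu by (intro mult_mono) auto
      finally show ?thesis using l by simp
    qed
    ultimately show ?thesis by (intro bexI[of _ "\<lambda>t. 1 / l * gelu ((l * w) * t + l * d)"]) auto
  qed
  from lin_comb_approx[OF g(1) half_gt_zero[OF e], of _ "{a..b}", OF this]
  obtain h where h: "h \<in> lin_comb {\<lambda>t. gelu (w * t + d) |w d. True}"
    "\<And>t. t \<in> {a..b} \<Longrightarrow> \<bar>g t - h t\<bar> < e / 2" by auto
  have "\<bar>f t - h t\<bar> < e" if "t \<in> {a..b}" for t
    using g(2)[OF that] h(2)[OF that] by linarith
  with h(1) show ?thesis by blast
qed

text \<open>
  The universality theorem for arbitrary continuous features that separate points: it serves for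
  networks on a ball of a Euclidean space as well as for functions of an \<open>L\<^sub>p\<close> class and a point.
  Exponentials are the right intermediate step because they turn sums in the span of \<open>A\<close> into
  products.
\<close>

theorem gelu_ridge_dense:
  fixes A :: "('x \<Rightarrow> real) set"
  assumes X: "compact_space X"
    and cont: "\<And>f. f \<in> A \<Longrightarrow> continuous_map X euclideanreal f"
    and sep: "\<And>x y. x \<in> topspace X \<Longrightarrow> y \<in> topspace X \<Longrightarrow> x \<noteq> y \<Longrightarrow> \<exists>f\<in>A. f x \<noteq> f y"
    and f: "continuous_map X euclideanreal f" and e: "e > 0"
  shows "\<exists>g\<in>lin_comb {\<lambda>x. gelu (t x + d) |t d. t \<in> lin_comb A}. \<forall>x\<in>topspace X. \<bar>f x - g x\<bar> < e"
proof -
  let ?E = "{\<lambda>x. exp (t x :: real) |t. t \<in> lin_comb A}"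
  let ?N = "{\<lambda>x. gelu (t x + d) |t d. t \<in> lin_comb A}"
  have contA: "continuous_map X euclideanreal t" if "t \<in> lin_comb A" for t
    using that cont by (rule continuous_map_lin_comb)
  have "\<exists>g\<in>lin_comb ?E. \<forall>x\<in>topspace X. \<bar>f x - g x\<bar> < e / 2"
  proof (rule Stone_Weierstrass_compact_space[OF X])
    have "continuous_map X euclideanreal (\<lambda>x. exp (t x))" if "t \<in> lin_comb A" for t
      using continuous_map_compose[OF contA[OF that], of euclideanreal exp]
      by (simp add: o_def continuous_on_exp)
    then show "continuous_map X euclideanreal g" if "g \<in> lin_comb ?E" for g
      using that by (auto intro: continuous_map_lin_comb)
    show "(\<lambda>x. g x * h x) \<in> lin_comb ?E" if "g \<in> lin_comb ?E" "h \<in> lin_comb ?E" for g h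
    proof (rule lin_comb_mult[OF _ that], clarify)
      fix s t assume "s \<in> lin_comb A" "t \<in> lin_comb A"
      then show "\<exists>u. (\<lambda>x. exp (s x) * exp (t x)) = (\<lambda>x. exp (u x)) \<and> u \<in> lin_comb A"
        by (intro exI[of _ "\<lambda>x. s x + t x"]) (auto simp: exp_add intro: lin_comb_add)
    qed
    have one: "(\<lambda>x. exp 0) \<in> ?E"
      by (rule CollectI, rule exI[of _ "\<lambda>x. 0"]) (simp add: lin_comb.zero)
    show "(\<lambda>_. c) \<in> lin_comb ?E" for c
      using lin_comb_scale[OF lin_comb_base[OF one], of c] by simp
    show "\<exists>g\<in>lin_comb ?E. g x \<noteq> g y" if "x \<in> topspace X" "y \<in> topspace X" "x \<noteq> y" for x y
    proof -
      obtain t where "t \<in> A" "t x \<noteq> t y" using sep[OF \<open>x \<in> topspace X\<close> \<open>y \<in> topspace X\<close> \<open>x \<noteq> y\<close>] by blast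
      then show ?thesis
        by (intro bexI[of _ "\<lambda>x. exp (t x)"] lin_comb_base) (auto intro: lin_comb_base)
    qed
  qed (use f e in \<open>auto intro: lin_comb_add\<close>)
  then obtain g where g: "g \<in> lin_comb ?E" "\<And>x. x \<in> topspace X \<Longrightarrow> \<bar>f x - g x\<bar> < e / 2"
    by blast
  have "\<exists>h\<in>lin_comb ?N. \<forall>x\<in>topspace X. \<bar>u x - h x\<bar> < e'" if u: "u \<in> ?E" and e': "e' > 0" for u e'
  proof -
    obtain t where t: "t \<in> lin_comb A" "u = (\<lambda>x. exp (t x))" using u by blast
    have "bounded (t ` topspace X)"
      using image_compactin[OF X[unfolded compact_space_def] contA[OF t(1)]]
      by (simp add: compact_imp_bounded)
    then obtain T where T: "T > 0" "\<And>x. x \<in> topspace X \<Longrightarrow> \<bar>t x\<bar> \<le> T"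
      unfolding bounded_pos by auto
    obtain h where h: "h \<in> lin_comb {\<lambda>t. gelu (w * t + d) |w d. True}"
      "\<And>s. s \<in> {-T..T} \<Longrightarrow> \<bar>exp s - h s\<bar> < e'"
      using gelu_dense_interval[of "-T" T exp e', OF continuous_on_exp[OF continuous_on_id] e'] T(1)
      by auto
    have "(\<lambda>x. h (t x)) \<in> lin_comb ?N"
    proof (rule lin_comb_compose[OF h(1)], clarify)
      fix w d
      show "\<exists>s d'. (\<lambda>x. gelu (w * t x + d)) = (\<lambda>x. gelu (s x + d')) \<and> s \<in> lin_comb A"
        by (intro exI[of _ "\<lambda>x. w * t x"] exI[of _ d]) (simp add: lin_comb_scale[OF t(1)])
    qed
    moreover have "\<bar>u x - h (t x)\<bar> < e'" if "x \<in> topspace X" for x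
      using h(2)[of "t x"] T(2)[OF that] t(2) by (simp add: abs_le_iff)
    ultimately show ?thesis by (intro bexI[of _ "\<lambda>x. h (t x)"]) auto
  qed
  from lin_comb_approx[OF g(1) half_gt_zero[OF e], of _ "topspace X", OF this]
  obtain h where h: "h \<in> lin_comb ?N" "\<And>x. x \<in> topspace X \<Longrightarrow> \<bar>g x - h x\<bar> < e / 2" by auto
  have "\<bar>f x - h x\<bar> < e" if "x \<in> topspace X" for x
    using g(2)[OF that] h(2)[OF that] by linarith
  with h(1) show ?thesis by blast
qed


section \<open>Calculus in \<open>L\<^sub>p\<close>\<close>

text \<open>
  \<open>Lp_class p S f\<close> makes sense for every function \<open>f\<close>. If it is an element of the space, it contains a
  function of \<open>L\<^sub>p\<close> that agrees with \<open>f\<close> almost everywhere, and by completeness of Lebesgue measure \<open>f\<close> is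
  measurable as well. Thus the extended inputs and outputs lie in \<open>L\<^sub>p\<close>, and the domains turn out to be
  measurable.
\<close>

lemma Lp_fun_if_class_in_space:
  fixes f :: "real^'d \<Rightarrow> 'b::euclidean_space"
  assumes S: "S \<in> sets lebesgue" and "Lp_class p S f \<in> Lp_space p S"
  shows "f \<in> Lp_fun p S"
proof -
  obtain g where g: "g \<in> Lp_fun p S" "Lp_class p S f = Lp_class p S g"
    using assms(2) by (auto simp: Lp_space_def)
  then have "g \<in> Lp_class p S f" using Lp_class_self by blast
  then have ae: "AE x in lebesgue_on S. g x = f x" by (simp add: Lp_class_def)
  then have "AE x in lebesgue. x \<in> S \<longrightarrow> g x = f x"
    using S by (simp add: AE_restrict_space_iff)
  then obtain N where N: "N \<in> null_sets lebesgue" "{x \<in> space lebesgue. \<not> (x \<in> S \<longrightarrow> g x = f x)} \<subseteq> N"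
    by (auto simp: eventually_ae_filter)
  have m: "g \<in> borel_measurable (lebesgue_on S)" using g(1) by (rule Lp_fun_measurable)
  then have "g measurable_on S" using measurable_on_iff_borel_measurable[OF S] by blast
  then have "f measurable_on S"
    by (rule measurable_on_spike[of _ _ N]) (use N in \<open>auto simp: negligible_iff_null_sets\<close>)
  then have fm: "f \<in> borel_measurable (lebesgue_on S)"
    using measurable_on_iff_borel_measurable[OF S] by blast
  have "integrable (lebesgue_on S) (\<lambda>x. norm (f x) powr p)"
    by (rule integrable_cong_AE_imp[OF Lp_fun_integrable[OF g(1)]])
      (use fm ae in \<open>auto elim: eventually_mono\<close>)
  with fm show ?thesis by (simp add: Lp_fun_def)
qed

lemma Lp_restrict:
  fixes f :: "real^'d \<Rightarrow> 'b::euclidean_space"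
  assumes S: "S \<in> sets lebesgue" and T: "T \<in> sets lebesgue" and ST: "S \<subseteq> T" and p: "1 \<le> p"
    and f: "f \<in> Lp_fun p T"
  shows "f \<in> Lp_fun p S" "Lp_norm p S f \<le> Lp_norm p T f"
proof -
  have fm: "f \<in> borel_measurable (lebesgue_on S)"
    using Lp_fun_measurable[OF f] ST by (rule measurable_restrict_mono)
  have iT: "integrable lebesgue (\<lambda>x. indicator T x *\<^sub>R norm (f x) powr p)"
    using Lp_fun_integrable[OF f] T by (simp add: integrable_restrict_space)
  have "integrable lebesgue (\<lambda>x. indicator S x *\<^sub>R (indicator T x *\<^sub>R norm (f x) powr p))"
    by (rule integrable_mult_indicator[OF S iT])
  also have "(\<lambda>x. indicator S x *\<^sub>R (indicator T x *\<^sub>R norm (f x) powr p)) =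
      (\<lambda>x. indicator S x *\<^sub>R norm (f x) powr p)"
    using ST by (auto simp: indicator_def fun_eq_iff)
  finally have iS: "integrable lebesgue (\<lambda>x. indicator S x *\<^sub>R norm (f x) powr p)" .
  then have "integrable (lebesgue_on S) (\<lambda>x. norm (f x) powr p)"
    using S by (simp add: integrable_restrict_space)
  with fm show "f \<in> Lp_fun p S" by (simp add: Lp_fun_def)
  have "(LINT x|lebesgue_on S. norm (f x) powr p) \<le> (LINT x|lebesgue_on T. norm (f x) powr p)"
    using S T ST iS iT
    by (auto simp: integral_restrict_space indicator_def intro!: integral_mono)
  then show "Lp_norm p S f \<le> Lp_norm p T f"
    unfolding Lp_norm_def using p by (intro powr_mono2) auto
qed

lemma Lp_cong:
  fixes f g :: "real^'d \<Rightarrow> 'b::euclidean_space"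
  assumes "\<And>x. x \<in> S \<Longrightarrow> f x = g x"
  shows "f \<in> Lp_fun p S \<longleftrightarrow> g \<in> Lp_fun p S" "Lp_norm p S f = Lp_norm p S g"
proof -
  have "f \<in> borel_measurable (lebesgue_on S) \<longleftrightarrow> g \<in> borel_measurable (lebesgue_on S)"
    using assms by (intro measurable_cong) auto
  moreover have "integrable (lebesgue_on S) (\<lambda>x. norm (f x) powr p) \<longleftrightarrow>
      integrable (lebesgue_on S) (\<lambda>x. norm (g x) powr p)"
    using assms by (intro Bochner_Integration.integrable_cong) auto
  ultimately show "f \<in> Lp_fun p S \<longleftrightarrow> g \<in> Lp_fun p S" by (simp add: Lp_fun_def)
  have "(LINT x|lebesgue_on S. norm (f x) powr p) = (LINT x|lebesgue_on S. norm (g x) powr p)"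
    using assms by (intro Bochner_Integration.integral_cong) auto
  then show "Lp_norm p S f = Lp_norm p S g" by (simp add: Lp_norm_def)
qed

lemma Lp_norm_bounded_le:
  fixes f :: "real^'d \<Rightarrow> 'b::euclidean_space"
  assumes p: "1 \<le> p" and S: "S \<in> lmeasurable" and f: "f \<in> Lp_fun p S" and C: "0 \<le> C"
    and le: "\<And>x. x \<in> S \<Longrightarrow> norm (f x) \<le> C"
  shows "Lp_norm p S f \<le> C * measure (lebesgue_on S) S powr (1 / p)"
proof -
  interpret finite_measure "lebesgue_on S" using S by (rule finite_measure_lebesgue_on)
  have "(LINT x|lebesgue_on S. norm (f x) powr p) \<le> (LINT x|lebesgue_on S. C powr p)"
    using le p by (intro integral_mono Lp_fun_integrable[OF f]) (auto intro: powr_mono2)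
  also have "\<dots> = C powr p * measure (lebesgue_on S) S" by simp
  finally have "Lp_norm p S f \<le> (C powr p * measure (lebesgue_on S) S) powr (1 / p)"
    unfolding Lp_norm_def using p by (intro powr_mono2) auto
  also have "\<dots> = C * measure (lebesgue_on S) S powr (1 / p)"
    using p C by (simp add: powr_mult powr_powr)
  finally show ?thesis .
qed

text \<open>
  The integrals of the neural layer run over \<open>\<Omega>\<close>, those of the functionals on \<open>L\<^sub>p\<close> over the cube.
\<close>

lemma lebesgue_on_support:
  fixes F :: "real^'d \<Rightarrow> real"
  assumes S: "S \<in> sets lebesgue" and T: "T \<in> sets lebesgue" and ST: "S \<subseteq> T"
    and F: "\<And>x. x \<in> T - S \<Longrightarrow> F x = 0"
  shows "integrable (lebesgue_on S) F \<longleftrightarrow> integrable (lebesgue_on T) F"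
    and "(LINT x|lebesgue_on S. F x) = (LINT x|lebesgue_on T. F x)"
proof -
  have "(\<lambda>x. indicator S x *\<^sub>R F x) = (\<lambda>x. indicator T x *\<^sub>R F x)"
    using F ST by (auto simp: indicator_def fun_eq_iff)
  then show "integrable (lebesgue_on S) F \<longleftrightarrow> integrable (lebesgue_on T) F"
    and "(LINT x|lebesgue_on S. F x) = (LINT x|lebesgue_on T. F x)"
    using S T by (simp_all add: integrable_restrict_space integral_restrict_space)
qed


text \<open>
  Uniform continuity settles the case of close arguments; for distant ones, boundedness of \<open>g\<close> is
  absorbed by the power of their distance. Integrated, this estimate bounds the change of
  \<open>\<integral> g(v)\<close> by an arbitrarily small constant and a multiple of \<open>\<parallel>v - w\<parallel>\<^sub>p\<^sup>p\<close>.
\<close>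

lemma continuous_modulus_powr:
  fixes g :: "'b::euclidean_space \<Rightarrow> real"
  assumes g: "continuous_on (cball 0 M) g" and p: "1 \<le> p" and e: "0 < e"
  obtains C where "0 \<le> C"
    "\<And>a b. norm a \<le> M \<Longrightarrow> norm b \<le> M \<Longrightarrow> \<bar>g a - g b\<bar> \<le> e + C * norm (a - b) powr p"
proof -
  have "uniformly_continuous_on (cball 0 M) g"
    using g by (intro compact_uniformly_continuous) auto
  then obtain d where d: "d > 0"
    "\<And>x y. x \<in> cball 0 M \<Longrightarrow> y \<in> cball 0 M \<Longrightarrow> dist x y < d \<Longrightarrow> dist (g x) (g y) < e"
    using e unfolding uniformly_continuous_on_def by metis
  have "bounded (g ` cball 0 M)"
    using g by (intro compact_imp_bounded compact_continuous_image) auto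
  then obtain G where G: "G > 0" "\<And>x. x \<in> cball 0 M \<Longrightarrow> \<bar>g x\<bar> \<le> G"
    unfolding bounded_pos by auto
  show ?thesis
  proof (rule that)
    show "0 \<le> 2 * G / d powr p" using G by simp
    fix a b :: 'b assume ab: "norm a \<le> M" "norm b \<le> M"
    show "\<bar>g a - g b\<bar> \<le> e + 2 * G / d powr p * norm (a - b) powr p"
    proof (cases "dist a b < d")
      case True
      then have "\<bar>g a - g b\<bar> \<le> e"
        using d(2)[of a b] ab by (simp add: dist_real_def)
      also have "\<dots> \<le> e + 2 * G / d powr p * norm (a - b) powr p" using G by simp
      finally show ?thesis .
    next
      case False
      then have "d powr p \<le> norm (a - b) powr p"
        using d p by (intro powr_mono2) (auto simp: dist_norm)
      then have "2 * G * 1 \<le> 2 * G * (norm (a - b) powr p / d powr p)"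
        using G d by (intro mult_left_mono) (auto simp: field_simps)
      moreover have "\<bar>g a - g b\<bar> \<le> 2 * G"
        using G(2)[of a] G(2)[of b] ab by simp
      ultimately show ?thesis using e by simp
    qed
  qed
qed

lemma borel_measurable_continuous_compose:
  assumes "continuous_on UNIV g" "v \<in> borel_measurable M"
  shows "(\<lambda>x. g (v x)) \<in> borel_measurable M"
  using measurable_compose[OF assms(2) borel_measurable_continuous_onI[OF assms(1)]] .

lemma integrable_continuous_compose:
  fixes v :: "real^'d \<Rightarrow> 'b::euclidean_space" and g :: "'b \<Rightarrow> 'c::euclidean_space"
  assumes S: "S \<in> lmeasurable" and g: "continuous_on UNIV g"
    and v: "v \<in> borel_measurable (lebesgue_on S)" "AE x in lebesgue_on S. norm (v x) \<le> M"
  shows "integrable (lebesgue_on S) (\<lambda>x. g (v x))"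
proof -
  interpret finite_measure "lebesgue_on S" using S by (rule finite_measure_lebesgue_on)
  have "bounded (g ` cball 0 M)"
    using g by (intro compact_imp_bounded compact_continuous_image) (auto intro: continuous_on_subset)
  then obtain G where G: "\<And>x. x \<in> cball 0 M \<Longrightarrow> norm (g x) \<le> G"
    unfolding bounded_iff by blast
  show ?thesis
  proof (rule integrable_const_bound)
    show "AE x in lebesgue_on S. norm (g (v x)) \<le> G"
      using v(2) by eventually_elim (auto intro: G)
  qed (rule borel_measurable_continuous_compose[OF g v(1)])
qed

text \<open>
  A functional on classes has to pick a representative; \<open>superposition_integral_class\<close> shows that for
  classes of \<open>L\<^sub>p\<close> functions any representative gives the same value.
\<close>

definition superposition_integral ::
  "(real^'d) set \<Rightarrow> ('b \<Rightarrow> real) \<Rightarrow> (real^'d \<Rightarrow> 'b) set \<Rightarrow> real" where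
  "superposition_integral S g X = (LINT x|lebesgue_on S. g ((SOME f. f \<in> X) x))"

lemma superposition_integral_class:
  fixes f :: "real^'d \<Rightarrow> 'b::euclidean_space"
  assumes f: "f \<in> Lp_fun p S" and g: "continuous_on UNIV g"
  shows "superposition_integral S g (Lp_class p S f) = (LINT x|lebesgue_on S. g (f x))"
proof -
  define f' where "f' = (SOME h. h \<in> Lp_class p S f)"
  have f': "f' \<in> Lp_class p S f"
    unfolding f'_def by (rule someI[of "\<lambda>h. h \<in> Lp_class p S f", OF Lp_class_self[OF f]])
  then have ae: "AE x in lebesgue_on S. f' x = f x" and m: "f' \<in> borel_measurable (lebesgue_on S)"
    by (auto simp: Lp_class_def Lp_fun_def)
  show ?thesis
    unfolding superposition_integral_def f'_def[symmetric]
    using ae by (intro integral_cong_AE borel_measurable_continuous_compose[OF g] m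
        Lp_fun_measurable[OF f]) auto
qed

lemma superposition_integral_continuous:
  fixes V :: "(real^'d \<Rightarrow> 'b::euclidean_space) set"
  assumes p: "1 \<le> p" and S: "S \<in> lmeasurable" and g: "continuous_on UNIV g"
    and V: "V \<subseteq> Lp_fun p S"
    and bdd: "\<And>v. v \<in> V \<Longrightarrow> AE x in lebesgue_on S. norm (v x) \<le> M"
  shows "continuous_map (subtopology (Lp_topology p S) (Lp_class p S ` V)) euclideanreal
           (superposition_integral S g)"
proof -
  interpret L: Metric_space "Lp_space p S :: (real^'d \<Rightarrow> 'b) set set" "Lp_dist p S"
    by (rule Metric_space_Lp[OF p])
  interpret K: Submetric "Lp_space p S :: (real^'d \<Rightarrow> 'b) set set" "Lp_dist p S" "Lp_class p S ` V"
    by unfold_locales (use V in \<open>auto simp: Lp_space_def\<close>)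
  interpret finite_measure "lebesgue_on S" using S by (rule finite_measure_lebesgue_on)
  have key: "\<exists>\<delta>>0. \<forall>w\<in>V. Lp_norm p S (\<lambda>x. v x - w x) < \<delta> \<longrightarrow>
       \<bar>(LINT x|lebesgue_on S. g (v x)) - (LINT x|lebesgue_on S. g (w x))\<bar> < \<epsilon>"
    if v: "v \<in> V" and \<epsilon>: "\<epsilon> > 0" for v \<epsilon>
  proof -
    define m where "m = measure (lebesgue_on S) S"
    have m: "m \<ge> 0" by (simp add: m_def)
    define e where "e = \<epsilon> / 2 / (m + 1)"
    have e: "e > 0" using \<epsilon> m by (simp add: e_def)
    have em: "e * m < \<epsilon> / 2"
    proof -
      have "e * m < e * (m + 1)" using e by simp
      also have "\<dots> = \<epsilon> / 2" using m by (simp add: e_def divide_simps)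
      finally show ?thesis .
    qed
    obtain C where C: "0 \<le> C"
      "\<And>a b. norm a \<le> M \<Longrightarrow> norm b \<le> M \<Longrightarrow> \<bar>g a - g b\<bar> \<le> e + C * norm (a - b) powr p"
      using continuous_modulus_powr[OF continuous_on_subset[OF g] p e, of M] by blast
    define \<delta> where "\<delta> = (\<epsilon> / 2 / (C + 1)) powr (1 / p)"
    have \<delta>: "\<delta> > 0" "C * \<delta> powr p \<le> \<epsilon> / 2"
    proof -
      show "\<delta> > 0" using \<epsilon> C(1) by (simp add: \<delta>_def)
      have "\<delta> powr p = \<epsilon> / 2 / (C + 1)"
        using \<epsilon> C(1) p by (simp add: \<delta>_def powr_powr)
      then have "C * \<delta> powr p = (C / (C + 1)) * (\<epsilon> / 2)" by simp
      also have "\<dots> \<le> 1 * (\<epsilon> / 2)"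
        using C(1) \<epsilon> by (intro mult_right_mono) auto
      finally show "C * \<delta> powr p \<le> \<epsilon> / 2" by simp
    qed
    have "\<bar>(LINT x|lebesgue_on S. g (v x)) - (LINT x|lebesgue_on S. g (w x))\<bar> < \<epsilon>"
      if w: "w \<in> V" and vw: "Lp_norm p S (\<lambda>x. v x - w x) < \<delta>" for w
    proof -
      have Lp: "v \<in> Lp_fun p S" "w \<in> Lp_fun p S" using v w V by auto
      have int: "integrable (lebesgue_on S) (\<lambda>x. g (v x))" "integrable (lebesgue_on S) (\<lambda>x. g (w x))"
        by (rule integrable_continuous_compose[OF S g Lp_fun_measurable[OF Lp(1)] bdd[OF v]],
            rule integrable_continuous_compose[OF S g Lp_fun_measurable[OF Lp(2)] bdd[OF w]])
      have intp: "integrable (lebesgue_on S) (\<lambda>x. norm (v x - w x) powr p)"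
        by (rule Lp_fun_integrable[OF Lp_fun_diff[OF p Lp]])
      have "\<bar>(LINT x|lebesgue_on S. g (v x)) - (LINT x|lebesgue_on S. g (w x))\<bar>
          = \<bar>LINT x|lebesgue_on S. g (v x) - g (w x)\<bar>"
        using int by simp
      also have "\<dots> \<le> (LINT x|lebesgue_on S. \<bar>g (v x) - g (w x)\<bar>)"
        by (rule integral_abs_bound)
      also have "\<dots> \<le> (LINT x|lebesgue_on S. e + C * norm (v x - w x) powr p)"
      proof (rule integral_mono_AE)
        show "AE x in lebesgue_on S. \<bar>g (v x) - g (w x)\<bar> \<le> e + C * norm (v x - w x) powr p"
          using bdd[OF v] bdd[OF w] by eventually_elim (rule C(2))
      qed (use int intp in auto)
      also have "\<dots> = e * m + C * Lp_norm p S (\<lambda>x. v x - w x) powr p"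
        using intp by (simp add: Lp_norm_powr[OF p] m_def)
      also have "C * Lp_norm p S (\<lambda>x. v x - w x) powr p \<le> C * \<delta> powr p"
        using vw p C(1) Lp_norm_nonneg by (intro mult_left_mono powr_mono2) (auto intro: less_imp_le)
      finally show ?thesis
        using em \<delta>(2) by linarith
    qed
    with \<delta>(1) show ?thesis by blast
  qed
  have "continuous_map K.sub.mtopology (Met_TC.mtopology :: real topology) (superposition_integral S g)"
    unfolding K.sub.metric_continuous_map[OF Met_TC.Metric_space_axioms]
  proof (intro conjI ballI allI impI)
    fix X \<epsilon> assume "X \<in> Lp_class p S ` V" and \<epsilon>: "(0::real) < \<epsilon>"
    then obtain v where v: "v \<in> V" "X = Lp_class p S v" by auto
    obtain \<delta> where \<delta>: "\<delta> > 0" "\<And>w. w \<in> V \<Longrightarrow> Lp_norm p S (\<lambda>x. v x - w x) < \<delta> \<Longrightarrow>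
       \<bar>(LINT x|lebesgue_on S. g (v x)) - (LINT x|lebesgue_on S. g (w x))\<bar> < \<epsilon>"
      using key[OF v(1) \<epsilon>] by blast
    have "dist (superposition_integral S g X) (superposition_integral S g Y) < \<epsilon>"
      if Y: "Y \<in> Lp_class p S ` V" and XY: "Lp_dist p S X Y < \<delta>" for Y
    proof -
      obtain w where w: "w \<in> V" "Y = Lp_class p S w" using Y by auto
      have Lp: "v \<in> Lp_fun p S" "w \<in> Lp_fun p S" using v w V by auto
      show ?thesis
        using \<delta>(2)[OF w(1)] XY
        by (simp add: v(2) w(2) Lp_dist_class[OF Lp] superposition_integral_class[OF Lp(1) g]
            superposition_integral_class[OF Lp(2) g] dist_real_def)
    qed
    with \<delta>(1) show "\<exists>\<delta>>0. \<forall>Y. Y \<in> Lp_class p S ` V \<and> Lp_dist p S X Y < \<delta> \<longrightarrow>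
        dist (superposition_integral S g X) (superposition_integral S g Y) < \<epsilon>"
      by blast
  qed auto
  then show ?thesis
    by (simp add: K.mtopology_submetric Lp_topology_def)
qed

lemma Lp_fun_bounded:
  fixes f :: "real^'d \<Rightarrow> 'b::euclidean_space"
  assumes S: "S \<in> lmeasurable" and f: "f \<in> borel_measurable (lebesgue_on S)"
    and M: "AE x in lebesgue_on S. norm (f x) \<le> M" and p: "1 \<le> p"
  shows "f \<in> Lp_fun p S"
proof -
  interpret finite_measure "lebesgue_on S" using S by (rule finite_measure_lebesgue_on)
  have "integrable (lebesgue_on S) (\<lambda>x. norm (f x) powr p)"
  proof (rule integrable_const_bound)
    show "AE x in lebesgue_on S. norm (norm (f x) powr p) \<le> M powr p"
      using M by eventually_elim (use p in \<open>auto intro!: powr_mono2\<close>)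
  qed (use f in measurable)
  with f show ?thesis by (simp add: Lp_fun_def)
qed

lemma Lp_norm_tendsto_0:
  fixes f :: "nat \<Rightarrow> real^'d \<Rightarrow> 'b::euclidean_space"
  assumes p: "1 \<le> p" and meas: "\<And>n. f n \<in> borel_measurable (lebesgue_on S)"
    and h: "integrable (lebesgue_on S) h"
    and lim: "AE x in lebesgue_on S. (\<lambda>n. f n x) \<longlonglongrightarrow> 0"
    and dom: "\<And>n. AE x in lebesgue_on S. norm (f n x) powr p \<le> h x"
  shows "(\<lambda>n. Lp_norm p S (f n)) \<longlonglongrightarrow> 0"
proof -
  have "(\<lambda>n. LINT x|lebesgue_on S. norm (f n x) powr p) \<longlonglongrightarrow> (LINT x|lebesgue_on S. 0)"
  proof (rule integral_dominated_convergence[OF _ _ h])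
    show "AE x in lebesgue_on S. (\<lambda>n. norm (f n x) powr p) \<longlonglongrightarrow> 0"
      using lim by eventually_elim
        (use p in \<open>auto intro!: tendsto_zero_powrI[OF _ tendsto_const] simp: tendsto_norm_zero\<close>)
  qed (use meas dom in auto)
  then show ?thesis
    unfolding Lp_norm_def using p
    by (intro tendsto_zero_powrI[OF _ tendsto_const]) auto
qed

text \<open>
  The function is first truncated, which is a small change in \<open>L\<^sub>p\<close> by dominated convergence. A
  Lebesgue measurable function is an almost everywhere limit of continuous ones; truncating these at
  the same height makes them dominated by a constant, so they converge in \<open>L\<^sub>p\<close>. Projection to a ball
  serves as truncation since it is continuous.
\<close>

lemma Lp_continuous_dense:
  fixes u :: "real^'d \<Rightarrow> 'b::euclidean_space"
  assumes p: "1 \<le> p" and S: "S \<in> lmeasurable" and u: "u \<in> Lp_fun p S" and e: "e > 0"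
  obtains w where "continuous_on UNIV w" "w \<in> Lp_fun p S" "Lp_norm p S (\<lambda>x. u x - w x) < e"
proof -
  interpret finite_measure "lebesgue_on S" using S by (rule finite_measure_lebesgue_on)
  have um[measurable]: "u \<in> borel_measurable (lebesgue_on S)" using u by (rule Lp_fun_measurable)
  define cl :: "nat \<Rightarrow> 'b \<Rightarrow> 'b" where "cl M = closest_point (cball 0 (real M))" for M
  have cl_cont: "continuous_on UNIV (cl M)" for M
    unfolding cl_def by (intro continuous_on_closest_point) auto
  have cl_bound: "norm (cl M z) \<le> real M" for M z
    using closest_point_in_set[of "cball 0 (real M)" z] by (simp add: cl_def)
  have cl_id: "cl M z = z" if "norm z \<le> real M" for M z
    using that closest_point_self[of z "cball 0 (real M)"] by (simp add: cl_def)
  have cl_le: "norm (cl M z) \<le> norm z" for M z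
    using closest_point_lipschitz[of "cball 0 (real M)" z 0] cl_id[of 0 M]
    by (simp add: cl_def)
  have cl_meas[measurable]: "(\<lambda>x. cl M (f x)) \<in> borel_measurable (lebesgue_on S)"
    if "f \<in> borel_measurable (lebesgue_on S)" for M f
    by (rule borel_measurable_continuous_compose[OF cl_cont that])
  have "(\<lambda>M. Lp_norm p S (\<lambda>x. u x - cl M (u x))) \<longlonglongrightarrow> 0"
  proof (rule Lp_norm_tendsto_0[OF p])
    show "integrable (lebesgue_on S) (\<lambda>x. 2 powr p * norm (u x) powr p)"
      by (intro integrable_mult_right Lp_fun_integrable[OF u])
    show "AE x in lebesgue_on S. (\<lambda>M. u x - cl M (u x)) \<longlonglongrightarrow> 0"
    proof (rule AE_I2, rule tendsto_eventually)
      fix x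
      obtain N where "norm (u x) \<le> real N" using real_arch_simple by blast
      then show "eventually (\<lambda>M. u x - cl M (u x) = 0) sequentially"
        by (intro eventually_sequentiallyI[of N]) (auto simp: cl_id)
    qed
    fix M
    have "norm (u x - cl M (u x)) powr p \<le> (2 * norm (u x)) powr p" for x
      using p norm_triangle_ineq4[of "u x" "cl M (u x)"] cl_le[of M "u x"] by (intro powr_mono2) auto
    then show "AE x in lebesgue_on S. norm (u x - cl M (u x)) powr p \<le> 2 powr p * norm (u x) powr p"
      by (simp add: powr_mult)
  qed (use cl_meas[OF um] in measurable)
  then have "eventually (\<lambda>M. Lp_norm p S (\<lambda>x. u x - cl M (u x)) < e / 2) sequentially"
    using order_tendstoD(2) half_gt_zero[OF e] by blast
  then obtain M where M: "Lp_norm p S (\<lambda>x. u x - cl M (u x)) < e / 2"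
    by (auto simp: eventually_sequentially)
  have "u measurable_on S"
    using measurable_on_iff_borel_measurable[of S u] S um by (simp add: fmeasurableD)
  then obtain N g where g: "negligible N" "\<And>n. continuous_on UNIV (g n)"
    "\<And>x. x \<notin> N \<Longrightarrow> (\<lambda>n. g n x) \<longlonglongrightarrow> (if x \<in> S then u x else 0)"
    by (auto simp: measurable_on_def)
  have g_cont: "continuous_on UNIV (\<lambda>x. cl M (g n x))" for n
    using continuous_on_compose2[OF cl_cont g(2)] by simp
  have g_meas[measurable]: "(\<lambda>x. cl M (g n x)) \<in> borel_measurable (lebesgue_on S)" for n
    using continuous_imp_measurable_on_sets_lebesgue[OF continuous_on_subset[OF g_cont]] S
    by (auto simp: fmeasurableD)
  have g_Lp: "(\<lambda>x. cl M (g n x)) \<in> Lp_fun p S" for n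
    by (rule Lp_fun_bounded[OF S g_meas _ p, of _ "real M"]) (auto simp: cl_bound)
  have u_Lp: "(\<lambda>x. cl M (u x)) \<in> Lp_fun p S"
    by (rule Lp_fun_bounded[OF S cl_meas[OF um] _ p, of _ "real M"]) (auto simp: cl_bound)
  have "(\<lambda>n. Lp_norm p S (\<lambda>x. cl M (u x) - cl M (g n x))) \<longlonglongrightarrow> 0"
  proof (rule Lp_norm_tendsto_0[OF p])
    show "integrable (lebesgue_on S) (\<lambda>x. (2 * real M) powr p)" by simp
    have "AE x in lebesgue_on S. x \<notin> N \<and> x \<in> S"
      using g(1) S
      by (auto simp: AE_restrict_space_iff fmeasurableD negligible_iff_null_sets AE_not_in
            intro: eventually_mono[OF AE_not_in])
    then show "AE x in lebesgue_on S. (\<lambda>n. cl M (u x) - cl M (g n x)) \<longlonglongrightarrow> 0"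
    proof eventually_elim
      case (elim x)
      then have "(\<lambda>n. g n x) \<longlonglongrightarrow> u x" using g(3)[of x] by simp
      then have "(\<lambda>n. cl M (g n x)) \<longlonglongrightarrow> cl M (u x)"
        by (rule continuous_on_tendsto_compose[OF cl_cont]) auto
      from tendsto_diff[OF tendsto_const[of "cl M (u x)"] this] show ?case by simp
    qed
    fix n
    have "norm (cl M (u x) - cl M (g n x)) \<le> 2 * real M" for x
      using norm_triangle_ineq4[of "cl M (u x)" "cl M (g n x)"] cl_bound[of M "u x"] cl_bound[of M "g n x"]
      by linarith
    then show "AE x in lebesgue_on S. norm (cl M (u x) - cl M (g n x)) powr p \<le> (2 * real M) powr p"
      using p by (intro AE_I2 powr_mono2) auto
  qed (use cl_meas[OF um] g_meas in measurable)
  then have "eventually (\<lambda>n. Lp_norm p S (\<lambda>x. cl M (u x) - cl M (g n x)) < e / 2) sequentially"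
    using order_tendstoD(2) half_gt_zero[OF e] by blast
  then obtain n where n: "Lp_norm p S (\<lambda>x. cl M (u x) - cl M (g n x)) < e / 2"
    by (auto simp: eventually_sequentially)
  have "Lp_norm p S (\<lambda>x. u x - cl M (g n x))
      \<le> Lp_norm p S (\<lambda>x. u x - cl M (u x)) + Lp_norm p S (\<lambda>x. cl M (u x) - cl M (g n x))"
    by (intro Lp_norm_triangle[OF p] Lp_fun_diff[OF p] u u_Lp g_Lp)
      (use norm_triangle_ineq in \<open>metis diff_add_cancel add_diff_eq\<close>)
  with M n have "Lp_norm p S (\<lambda>x. u x - cl M (g n x)) < e" by linarith
  with that[OF g_cont g_Lp] show ?thesis by blast
qed

text \<open>
  If \<open>\<xi>\<close> is continuous and close to \<open>f\<close> in \<open>L\<^sub>1\<close>, then orthogonality gives \<open>\<integral> f\<^sup>2 = \<integral> f (f - \<xi>)\<close>, which is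
  small because \<open>f\<close> is bounded.
\<close>

lemma AE_zero_if_orthogonal_to_continuous:
  fixes f :: "real^'d \<Rightarrow> real"
  assumes S: "S \<in> lmeasurable" and f: "f \<in> borel_measurable (lebesgue_on S)"
    and M: "AE x in lebesgue_on S. \<bar>f x\<bar> \<le> M"
    and orth: "\<And>\<xi>. continuous_on UNIV \<xi> \<Longrightarrow> (LINT x|lebesgue_on S. \<xi> x * f x) = 0"
  shows "AE x in lebesgue_on S. f x = 0"
proof -
  have fLp: "f \<in> Lp_fun 1 S" using Lp_fun_bounded[OF S f, of M 1] M by simp
  define M' where "M' = max M 1"
  have M': "M' > 0" "AE x in lebesgue_on S. \<bar>f x\<bar> \<le> M'"
    using M by (auto simp: M'_def le_max_iff_disj)
  have sq: "integrable (lebesgue_on S) (\<lambda>x. (f x)\<^sup>2)"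
    by (rule integrable_continuous_compose[OF S _ f, of "\<lambda>z. z\<^sup>2" M]) (use M in \<open>auto intro!: continuous_intros\<close>)
  have "(LINT x|lebesgue_on S. (f x)\<^sup>2) \<le> 0"
  proof (rule field_le_epsilon)
    fix e :: real assume e: "e > 0"
    obtain \<xi> where \<xi>: "continuous_on UNIV \<xi>" "\<xi> \<in> Lp_fun 1 S" "Lp_norm 1 S (\<lambda>x. f x - \<xi> x) < e / M'"
      using Lp_continuous_dense[OF _ S fLp, of "e / M'"] e M' by auto
    have dLp: "(\<lambda>x. f x - \<xi> x) \<in> Lp_fun 1 S" by (rule Lp_fun_diff[OF _ fLp \<xi>(2)]) simp
    then have dint: "integrable (lebesgue_on S) (\<lambda>x. \<bar>f x - \<xi> x\<bar>)"
      using Lp_fun_integrable by fastforce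
    have dmeas[measurable]: "(\<lambda>x. f x - \<xi> x) \<in> borel_measurable (lebesgue_on S)"
      using dLp by (rule Lp_fun_measurable)
    note f[measurable]
    have fd: "integrable (lebesgue_on S) (\<lambda>x. f x * (f x - \<xi> x))"
    proof (rule Bochner_Integration.integrable_bound[OF integrable_mult_right[OF dint, of M']])
      show "AE x in lebesgue_on S. norm (f x * (f x - \<xi> x)) \<le> norm (M' * \<bar>f x - \<xi> x\<bar>)"
        using M'(2) by eventually_elim (use M'(1) in \<open>auto simp: abs_mult intro!: mult_right_mono\<close>)
    qed measurable
    have "(LINT x|lebesgue_on S. (f x)\<^sup>2) - (LINT x|lebesgue_on S. f x * (f x - \<xi> x))
        = (LINT x|lebesgue_on S. (f x)\<^sup>2 - f x * (f x - \<xi> x))"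
      using sq fd by simp
    also have "\<dots> = (LINT x|lebesgue_on S. \<xi> x * f x)"
      by (intro Bochner_Integration.integral_cong) (auto simp: power2_eq_square algebra_simps)
    also have "\<dots> = 0" by (rule orth[OF \<xi>(1)])
    finally have "(LINT x|lebesgue_on S. (f x)\<^sup>2) = (LINT x|lebesgue_on S. f x * (f x - \<xi> x))" by simp
    also have "\<dots> \<le> (LINT x|lebesgue_on S. M' * \<bar>f x - \<xi> x\<bar>)"
    proof (rule integral_mono_AE[OF fd integrable_mult_right[OF dint]])
      show "AE x in lebesgue_on S. f x * (f x - \<xi> x) \<le> M' * \<bar>f x - \<xi> x\<bar>"
        using M'(2)
      proof eventually_elim
        case (elim x)
        have "f x * (f x - \<xi> x) \<le> \<bar>f x\<bar> * \<bar>f x - \<xi> x\<bar>" by (metis abs_ge_self abs_mult)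
        also have "\<dots> \<le> M' * \<bar>f x - \<xi> x\<bar>" using elim by (intro mult_right_mono) auto
        finally show ?case .
      qed
    qed
    also have "\<dots> = M' * Lp_norm 1 S (\<lambda>x. f x - \<xi> x)"
      by (simp add: Lp_norm_def)
    also have "\<dots> \<le> M' * (e / M')" using \<xi>(3) M'(1) by (intro mult_left_mono) auto
    also have "\<dots> = 0 + e" using M'(1) by simp
    finally show "(LINT x|lebesgue_on S. (f x)\<^sup>2) \<le> 0 + e" .
  qed
  moreover have "(LINT x|lebesgue_on S. (f x)\<^sup>2) \<ge> 0" by simp
  ultimately have "(LINT x|lebesgue_on S. (f x)\<^sup>2) = 0" by simp
  then have "AE x in lebesgue_on S. (f x)\<^sup>2 = 0"
    using integral_nonneg_eq_0_iff_AE[OF sq] by simp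
  then show ?thesis by simp
qed


lemma Lp_fun_0: "(\<lambda>x. 0) \<in> Lp_fun p S"
  by (simp add: Lp_fun_def)

lemma Lp_fun_add:
  assumes "1 \<le> p" "f \<in> Lp_fun p S" "g \<in> Lp_fun p S"
  shows "(\<lambda>x. f x + g x) \<in> Lp_fun p S"
  using Lp_fun_diff[OF assms(1,2) Lp_fun_diff[OF assms(1) Lp_fun_0 assms(3)]] by simp

lemma Lp_fun_scaleR:
  assumes "f \<in> Lp_fun p S"
  shows "(\<lambda>x. c *\<^sub>R f x) \<in> Lp_fun p S"
proof -
  have [measurable]: "f \<in> borel_measurable (lebesgue_on S)" using assms by (rule Lp_fun_measurable)
  have "integrable (lebesgue_on S) (\<lambda>x. \<bar>c\<bar> powr p * norm (f x) powr p)"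
    by (intro integrable_mult_right Lp_fun_integrable[OF assms])
  then show ?thesis
    by (simp add: Lp_fun_def powr_mult)
qed

lemma Lp_norm_scaleR:
  assumes "1 \<le> p"
  shows "Lp_norm p S (\<lambda>x. c *\<^sub>R f x) = \<bar>c\<bar> * Lp_norm p S f"
proof -
  have "Lp_norm p S (\<lambda>x. c *\<^sub>R f x) = (\<bar>c\<bar> powr p * (LINT x|lebesgue_on S. norm (f x) powr p)) powr (1 / p)"
    by (simp add: Lp_norm_def powr_mult)
  also have "\<dots> = \<bar>c\<bar> * Lp_norm p S f"
    unfolding powr_mult Lp_norm_def using assms by (simp add: powr_powr)
  finally show ?thesis .
qed

lemma Lp_norm_sum_le:
  assumes p: "1 \<le> p" and I: "finite I" and f: "\<And>i. i \<in> I \<Longrightarrow> f i \<in> Lp_fun p S"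
  shows "(\<lambda>x. \<Sum>i\<in>I. c i *\<^sub>R f i x) \<in> Lp_fun p S \<and>
    Lp_norm p S (\<lambda>x. \<Sum>i\<in>I. c i *\<^sub>R f i x) \<le> (\<Sum>i\<in>I. \<bar>c i\<bar> * Lp_norm p S (f i))"
  using I f
proof induction
  case empty
  show ?case using p by (simp add: Lp_fun_0 Lp_norm_def)
next
  case (insert i I)
  then have IH: "(\<lambda>x. \<Sum>i\<in>I. c i *\<^sub>R f i x) \<in> Lp_fun p S"
    "Lp_norm p S (\<lambda>x. \<Sum>i\<in>I. c i *\<^sub>R f i x) \<le> (\<Sum>i\<in>I. \<bar>c i\<bar> * Lp_norm p S (f i))"
    by auto
  have fi: "(\<lambda>x. c i *\<^sub>R f i x) \<in> Lp_fun p S" using insert.prems by (auto intro: Lp_fun_scaleR)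
  have sum: "(\<lambda>x. c i *\<^sub>R f i x + (\<Sum>i\<in>I. c i *\<^sub>R f i x)) \<in> Lp_fun p S"
    by (rule Lp_fun_add[OF p fi IH(1)])
  have "Lp_norm p S (\<lambda>x. c i *\<^sub>R f i x + (\<Sum>i\<in>I. c i *\<^sub>R f i x))
      \<le> Lp_norm p S (\<lambda>x. c i *\<^sub>R f i x) + Lp_norm p S (\<lambda>x. \<Sum>i\<in>I. c i *\<^sub>R f i x)"
    by (rule Lp_norm_triangle[OF p fi IH(1) sum norm_triangle_ineq])
  with IH(2) sum insert.hyps show ?case
    by (simp add: Lp_norm_scaleR[OF p])
qed

text \<open>
  The image of \<open>F\<close> is compact and covered by the balls of radius \<open>e\<close> around continuous functions; \<open>W\<close>
  consists of the centres of finitely many that suffice. The coefficients form the partition of unity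
  given by the normalized values \<open>(e - \<parallel>F x - w\<parallel>)\<^sup>+\<close>, so only centres within \<open>e\<close> of \<open>F x\<close> contribute to
  the convex combination.
\<close>

theorem Lp_valued_map_approximation:
  fixes F :: "'x \<Rightarrow> (real^'d \<Rightarrow> 'b::euclidean_space) set"
  assumes p: "1 \<le> p" and S: "S \<in> lmeasurable" and X: "compact_space X"
    and F: "continuous_map X (Lp_topology p S) F" and e: "e > 0"
  obtains W :: "(real^'d \<Rightarrow> 'b) set" and c where "finite W"
    "\<And>w. w \<in> W \<Longrightarrow> continuous_on UNIV w \<and> w \<in> Lp_fun p S"
    "\<And>w. w \<in> W \<Longrightarrow> continuous_map X euclideanreal (c w)"
    "\<And>x u. x \<in> topspace X \<Longrightarrow> u \<in> Lp_fun p S \<Longrightarrow> F x = Lp_class p S u \<Longrightarrow>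
       Lp_norm p S (\<lambda>y. u y - (\<Sum>w\<in>W. c w x *\<^sub>R w y)) \<le> e"
proof -
  interpret L: Metric_space "Lp_space p S :: (real^'d \<Rightarrow> 'b) set set" "Lp_dist p S"
    by (rule Metric_space_Lp[OF p])
  define C where "C = {w :: real^'d \<Rightarrow> 'b. continuous_on UNIV w \<and> w \<in> Lp_fun p S}"
  define U where "U w = {x \<in> topspace X. F x \<in> L.mball (Lp_class p S w) e}" for w
  have F': "continuous_map X L.mtopology F" using F by (simp add: Lp_topology_def)
  have FX: "F x \<in> Lp_space p S" if "x \<in> topspace X" for x
    using continuous_map_image_subset_topspace[OF F'] that by auto
  have cls: "Lp_class p S w \<in> Lp_space p S" if "w \<in> C" for w
    using that by (auto simp: C_def Lp_space_def)
  have openU: "openin X (U w)" for w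
    unfolding U_def using F' L.openin_mball by (rule openin_continuous_map_preimage)
  have "\<exists>w\<in>C. x \<in> U w" if x: "x \<in> topspace X" for x
  proof -
    obtain u where u: "u \<in> Lp_fun p S" "F x = Lp_class p S u"
      using FX[OF x] by (auto simp: Lp_space_def)
    obtain w where w: "continuous_on UNIV w" "w \<in> Lp_fun p S" "Lp_norm p S (\<lambda>y. u y - w y) < e"
      using Lp_continuous_dense[OF p S u(1) e] .
    then have wC: "w \<in> C" by (simp add: C_def)
    moreover have "Lp_dist p S (F x) (Lp_class p S w) < e"
      using w(3) unfolding u(2) Lp_dist_class[OF u(1) w(2)] .
    ultimately show ?thesis
      using x FX[OF x] cls[OF wC] by (auto simp: U_def L.commute)
  qed
  then have "topspace X \<subseteq> \<Union> (U ` C)" by auto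
  with X openU obtain \<V> where "finite \<V>" "\<V> \<subseteq> U ` C" "topspace X \<subseteq> \<Union> \<V>"
    unfolding compact_space_def compactin_def by (metis (no_types, lifting) imageE)
  then obtain W where W: "finite W" "W \<subseteq> C" "topspace X \<subseteq> \<Union> (U ` W)"
    by (metis finite_subset_image)
  define d where "d w x = max 0 (e - Lp_dist p S (F x) (Lp_class p S w))" for w x
  define c where "c w x = d w x / (\<Sum>w\<in>W. d w x)" for w x
  have d_pos: "(\<Sum>w\<in>W. d w x) > 0" if x: "x \<in> topspace X" for x
  proof -
    obtain w where w: "w \<in> W" "x \<in> U w" using W(3) x by blast
    then have "d w x > 0" by (auto simp: U_def d_def L.commute)
    then show ?thesis using w(1) W(1) by (intro sum_pos2[of W w]) (auto simp: d_def)
  qed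
  have d_cont: "continuous_map X euclideanreal (d w)" if "w \<in> W" for w
  proof -
    have "Lp_class p S w \<in> Lp_space p S" using that W(2) by (auto intro: cls)
    then have "continuous_map X euclideanreal (\<lambda>x. mdist (metric (Lp_space p S, Lp_dist p S)) (F x) (Lp_class p S w))"
      by (intro continuous_map_mdist) (auto simp: F')
    then have "continuous_map X euclideanreal (\<lambda>x. Lp_dist p S (F x) (Lp_class p S w))"
      by simp
    then show ?thesis
      unfolding d_def by (intro continuous_map_real_max continuous_map_diff) auto
  qed
  show ?thesis
  proof (rule that[of W c])
    show "finite W" by (rule W(1))
    show "continuous_on UNIV w \<and> w \<in> Lp_fun p S" if "w \<in> W" for w
      using that W(2) by (auto simp: C_def)
    show "continuous_map X euclideanreal (c w)" if "w \<in> W" for w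
      unfolding c_def using d_pos
      by (intro continuous_map_real_divide d_cont that continuous_map_sum W(1)) force+
    fix x u assume x: "x \<in> topspace X" and u: "u \<in> Lp_fun p S" "F x = Lp_class p S u"
    have c: "c w x \<ge> 0" "(\<Sum>w\<in>W. c w x) = 1" for w
      using d_pos[OF x] by (auto simp: c_def d_def sum_divide_distrib[symmetric])
    have Wp: "w \<in> Lp_fun p S" if "w \<in> W" for w using that W(2) by (auto simp: C_def)
    have "u y - (\<Sum>w\<in>W. c w x *\<^sub>R w y) = (\<Sum>w\<in>W. c w x *\<^sub>R (u y - w y))" for y
      using c(2) by (simp add: scaleR_diff_right sum_subtractf scaleR_sum_left[symmetric])
    then have "Lp_norm p S (\<lambda>y. u y - (\<Sum>w\<in>W. c w x *\<^sub>R w y)) =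
        Lp_norm p S (\<lambda>y. \<Sum>w\<in>W. c w x *\<^sub>R (u y - w y))" by simp
    also have "\<dots> \<le> (\<Sum>w\<in>W. \<bar>c w x\<bar> * Lp_norm p S (\<lambda>y. u y - w y))"
      using Lp_norm_sum_le[OF p W(1), of "\<lambda>w y. u y - w y" S "\<lambda>w. c w x"] Lp_fun_diff[OF p u(1) Wp]
      by blast
    also have "\<dots> \<le> (\<Sum>w\<in>W. c w x * e)"
    proof (rule sum_mono)
      fix w assume w: "w \<in> W"
      show "\<bar>c w x\<bar> * Lp_norm p S (\<lambda>y. u y - w y) \<le> c w x * e"
      proof (cases "c w x = 0")
        case False
        then have "d w x \<noteq> 0" by (auto simp: c_def)
        then have "Lp_dist p S (F x) (Lp_class p S w) \<le> e" by (auto simp: d_def max_def split: if_splits)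
        then have "Lp_norm p S (\<lambda>y. u y - w y) \<le> e"
          by (simp add: u(2) Lp_dist_class[OF u(1) Wp[OF w]])
        then show ?thesis using c(1)[of w] by (simp add: mult_left_mono)
      qed simp
    qed
    also have "\<dots> = e" using c(2) by (simp add: sum_distrib_right[symmetric])
    finally show "Lp_norm p S (\<lambda>y. u y - (\<Sum>w\<in>W. c w x *\<^sub>R w y)) \<le> e" .
  qed
qed

section \<open>Separation of extended inputs\<close>

definition gelu_neurons :: "(real^'n \<Rightarrow> real) set" where
  "gelu_neurons = {\<lambda>z. gelu (\<omega> \<bullet> z + b) |\<omega> b. True}"

lemma continuous_gelu_neurons:
  assumes "h \<in> gelu_neurons"
  shows "continuous_on S h"
  using assms unfolding gelu_neurons_def
  by (auto intro!: continuous_on_compose2[OF continuous_on_gelu[of UNIV]] continuous_intros)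

lemma lin_comb_coordinates:
  assumes "t \<in> lin_comb {\<lambda>z :: real^'n. z $ i |i. True}"
  shows "\<exists>\<omega>. t = (\<lambda>z. \<omega> \<bullet> z)"
  using assms
proof induction
  case zero
  show ?case by (intro exI[of _ 0]) auto
next
  case (step g f c)
  then obtain i \<omega> where "g = (\<lambda>z. z $ i)" "f = (\<lambda>z. \<omega> \<bullet> z)" by blast
  then show ?case
    by (intro exI[of _ "c *\<^sub>R axis i 1 + \<omega>"]) (simp add: inner_add_left inner_axis' fun_eq_iff)
qed

lemma coordinate_in_gelu_network: "(\<lambda>z :: real^'n. z $ i) \<in> lin_comb gelu_neurons"
proof -
  have n: "(\<lambda>z :: real^'n. gelu (\<omega> \<bullet> z + b)) \<in> lin_comb gelu_neurons" for \<omega> b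
    by (rule lin_comb_base) (auto simp: gelu_neurons_def)
  have "(\<lambda>z :: real^'n. gelu (axis i 1 \<bullet> z + 0) + - 1 * gelu (- axis i 1 \<bullet> z + 0)) \<in> lin_comb gelu_neurons"
    by (intro lin_comb_add lin_comb_scale n)
  also have "(\<lambda>z :: real^'n. gelu (axis i 1 \<bullet> z + 0) + - 1 * gelu (- axis i 1 \<bullet> z + 0)) = (\<lambda>z. z $ i)"
    using gelu_diff by (simp add: inner_axis')
  finally show ?thesis .
qed

lemma gelu_network_dense:
  fixes g :: "real^'n \<Rightarrow> real"
  assumes g: "continuous_on (cball 0 M) g" and e: "e > 0"
  shows "\<exists>h\<in>lin_comb gelu_neurons. \<forall>z\<in>cball 0 M. \<bar>g z - h z\<bar> < e"
proof -
  let ?A = "{\<lambda>z :: real^'n. z $ i |i. True}"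
  have "\<exists>h\<in>lin_comb {\<lambda>z. gelu (t z + d) |t d. t \<in> lin_comb ?A}.
      \<forall>z\<in>topspace (top_of_set (cball 0 M)). \<bar>g z - h z\<bar> < e"
  proof (rule gelu_ridge_dense)
    show "compact_space (top_of_set (cball (0 :: real^'n) M))"
      by (simp add: compact_space_subtopology)
    show "continuous_map (top_of_set (cball 0 M)) euclideanreal f" if "f \<in> ?A" for f
      using that by (auto intro!: continuous_intros)
    show "\<exists>f\<in>?A. f x \<noteq> f y" if "x \<noteq> y" for x y
      using that by (auto simp: vec_eq_iff)
  qed (use g e in auto)
  then obtain h where h: "h \<in> lin_comb {\<lambda>z. gelu (t z + d) |t d. t \<in> lin_comb ?A}"
    "\<And>z. z \<in> cball 0 M \<Longrightarrow> \<bar>g z - h z\<bar> < e"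
    by auto
  have "(\<lambda>z. h z) \<in> lin_comb gelu_neurons"
    by (rule lin_comb_compose[OF h(1)]) (use lin_comb_coordinates in \<open>force simp: gelu_neurons_def\<close>)
  with h(2) show ?thesis by (intro bexI[of _ h]) auto
qed

definition point_part :: "real^('a::finite + 'd::finite + unit) \<Rightarrow> real^'d" where
  "point_part z = (\<chi> s. z $ Inr (Inl s))"

definition density_part :: "real^('a::finite + 'd::finite + unit) \<Rightarrow> real" where
  "density_part z = z $ Inr (Inr ())"

lemma continuous_on_point_part: "continuous_on S point_part"
  unfolding point_part_def by (intro continuous_intros)

lemma continuous_on_density_part: "continuous_on S density_part"
  unfolding density_part_def by (intro continuous_intros)

text \<open>
  The pointwise property of the extensions by zero from which an input can be reconstructed: the
  support is where the density is positive, and on it the position channel is the position.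
\<close>

definition extended_input :: "(real^'d::finite) set \<Rightarrow> (real^'d \<Rightarrow> real^('a::finite + 'd::finite + unit)) \<Rightarrow> bool" where
  "extended_input S v \<longleftrightarrow> (\<forall>x\<in>S. v x = 0 \<or> 0 < density_part (v x) \<and> point_part (v x) = x)"

text \<open>
  The hypothesis extends from neurons to networks by linearity and to all continuous \<open>g\<close> by density of
  networks on the ball that contains almost all values. Inserting \<open>\<xi>(position) g\<close> for \<open>g\<close> yields
  \<open>\<integral> \<xi>(x) g(v(x)) \<rho>\<^sub>v(x) dx\<close>, since outside the support the factor \<open>\<rho>\<^sub>v\<close> vanishes. As \<open>\<xi>\<close> is arbitrary,
  \<open>g(v) \<rho>\<^sub>v = g(w) \<rho>\<^sub>w\<close> almost everywhere. The constant \<open>g\<close> gives \<open>\<rho>\<^sub>v = \<rho>\<^sub>w\<close>, and the coordinates give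
  \<open>v = w\<close> where this density is positive; elsewhere both are zero.
\<close>

theorem extended_input_determined:
  fixes v w :: "real^'d \<Rightarrow> real^('a::finite + 'd::finite + unit)"
  assumes S: "S \<in> lmeasurable"
    and v: "v \<in> borel_measurable (lebesgue_on S)" "AE x in lebesgue_on S. norm (v x) \<le> M" "extended_input S v"
    and w: "w \<in> borel_measurable (lebesgue_on S)" "AE x in lebesgue_on S. norm (w x) \<le> M" "extended_input S w"
    and eq: "\<And>h. h \<in> gelu_neurons \<Longrightarrow> (LINT x|lebesgue_on S. h (v x) * density_part (v x))
               = (LINT x|lebesgue_on S. h (w x) * density_part (w x))"
  shows "AE x in lebesgue_on S. v x = w x"
proof -
  interpret finite_measure "lebesgue_on S" using S by (rule finite_measure_lebesgue_on)
  define J where "J u g = (LINT x|lebesgue_on S. g (u x) * density_part (u x))"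
    for u :: "real^'d \<Rightarrow> real^('a::finite + 'd::finite + unit)" and g
  have int: "integrable (lebesgue_on S) (\<lambda>x. g (u x) * density_part (u x))"
    if "u = v \<or> u = w" "continuous_on UNIV g" for u and g :: "real^('a::finite + 'd::finite + unit) \<Rightarrow> real"
    by (rule integrable_continuous_compose[OF S, of "\<lambda>z. g z * density_part z" u M])
      (use that v w in \<open>auto intro!: continuous_intros continuous_on_density_part\<close>)
  have cont_net: "continuous_on UNIV h" if "h \<in> lin_comb gelu_neurons" for h :: "real^('a::finite + 'd::finite + unit) \<Rightarrow> real"
    using continuous_map_lin_comb[OF that, of euclidean] by (auto simp: continuous_gelu_neurons)
  have net: "J v h = J w h" if "h \<in> lin_comb gelu_neurons" for h
    using that
  proof induction
    case zero
    show ?case by (simp add: J_def)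
  next
    case (step g f c)
    have "J u (\<lambda>x. c * g x + f x) = c * J u g + J u f" if "u = v \<or> u = w" for u
    proof -
      have "J u (\<lambda>x. c * g x + f x) =
          (LINT x|lebesgue_on S. c * (g (u x) * density_part (u x)) + f (u x) * density_part (u x))"
        unfolding J_def by (intro Bochner_Integration.integral_cong) (auto simp: algebra_simps)
      also have "\<dots> = c * J u g + J u f"
        unfolding J_def
        using int[OF that continuous_gelu_neurons[OF step.hyps(1)]] int[OF that cont_net[OF step.hyps(2)]]
        by simp
      finally show ?thesis .
    qed
    then show ?case
      using step.IH eq[OF step.hyps(1)] by (simp add: J_def)
  qed
  have close: "\<bar>J u g - J u h\<bar> \<le> e * (\<bar>M\<bar> * measure (lebesgue_on S) S)"
    if u: "u = v \<or> u = w" and g: "continuous_on UNIV g" and h: "h \<in> lin_comb gelu_neurons"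
      and gh: "\<forall>z\<in>cball 0 M. \<bar>g z - h z\<bar> < e" for u g h e
  proof -
    have "J u g - J u h = (LINT x|lebesgue_on S. g (u x) * density_part (u x) - h (u x) * density_part (u x))"
      unfolding J_def using int[OF u g] int[OF u cont_net[OF h]] by simp
    also have "\<bar>\<dots>\<bar> \<le> (LINT x|lebesgue_on S. \<bar>g (u x) * density_part (u x) - h (u x) * density_part (u x)\<bar>)"
      by (rule integral_abs_bound)
    also have "\<dots> \<le> (LINT x|lebesgue_on S. e * \<bar>M\<bar>)"
    proof (rule integral_mono_AE)
      have "AE x in lebesgue_on S. norm (u x) \<le> M" using u v w by auto
      then show "AE x in lebesgue_on S. \<bar>g (u x) * density_part (u x) - h (u x) * density_part (u x)\<bar> \<le> e * \<bar>M\<bar>"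
      proof eventually_elim
        case (elim x)
        have "\<bar>density_part (u x)\<bar> \<le> \<bar>M\<bar>"
          using component_le_norm_cart[of "u x" "Inr (Inr ())"] elim by (simp add: density_part_def)
        moreover have "\<bar>g (u x) - h (u x)\<bar> \<le> e" using gh elim by (auto intro: less_imp_le)
        ultimately show ?case
          unfolding left_diff_distrib[symmetric] abs_mult by (intro mult_mono) auto
      qed
    qed (use int[OF u g] int[OF u cont_net[OF h]] in auto)
    also have "\<dots> = e * (\<bar>M\<bar> * measure (lebesgue_on S) S)" by simp
    finally show ?thesis .
  qed
  have all: "J v g = J w g" if g: "continuous_on UNIV g" for g
  proof -
    define k where "k = \<bar>M\<bar> * measure (lebesgue_on S) S"
    have k: "k \<ge> 0" by (simp add: k_def)
    have "\<bar>J v g - J w g\<bar> \<le> 0 + e" if e: "e > 0" for e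
    proof -
      define e' where "e' = e / 2 / (k + 1)"
      have e': "e' > 0" "e' * k \<le> e / 2"
      proof -
        show "e' > 0" using e k by (simp add: e'_def)
        have "e' * k = (e / 2) * (k / (k + 1))" by (simp add: e'_def)
        also have "\<dots> \<le> (e / 2) * 1" using e k by (intro mult_left_mono) auto
        finally show "e' * k \<le> e / 2" by simp
      qed
      obtain h where h: "h \<in> lin_comb gelu_neurons" "\<forall>z\<in>cball 0 M. \<bar>g z - h z\<bar> < e'"
        using gelu_network_dense[OF continuous_on_subset[OF g] e'(1)] by blast
      have "\<bar>J v g - J v h\<bar> \<le> e' * k" "\<bar>J w g - J w h\<bar> \<le> e' * k"
        using close[OF _ g h] by (simp_all add: k_def)
      then show ?thesis using net[OF h(1)] e'(2) by linarith
    qed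
    then have "\<bar>J v g - J w g\<bar> \<le> 0" by (rule field_le_epsilon)
    then show ?thesis by simp
  qed
  have wt: "AE x in lebesgue_on S. g (v x) * density_part (v x) = g (w x) * density_part (w x)"
    if g: "continuous_on UNIV g" for g
  proof -
    let ?f = "\<lambda>x. g (v x) * density_part (v x) - g (w x) * density_part (w x)"
    have c: "continuous_on UNIV (\<lambda>z. g z * density_part z)"
      by (intro continuous_intros g continuous_on_density_part)
    have "bounded ((\<lambda>z. g z * density_part z) ` cball 0 M)"
      by (intro compact_imp_bounded compact_continuous_image continuous_on_subset[OF c]) auto
    then obtain G where G: "\<And>z. z \<in> cball 0 M \<Longrightarrow> \<bar>g z * density_part z\<bar> \<le> G"
      unfolding bounded_iff real_norm_def by blast
    have "AE x in lebesgue_on S. ?f x = 0"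
    proof (rule AE_zero_if_orthogonal_to_continuous[OF S])
      show "?f \<in> borel_measurable (lebesgue_on S)"
        using int[OF _ g] by (intro borel_measurable_diff borel_measurable_integrable) auto
      show "AE x in lebesgue_on S. \<bar>?f x\<bar> \<le> 2 * G"
        using v(2) w(2)
      proof eventually_elim
        case (elim x)
        then show ?case using G[of "v x"] G[of "w x"] by simp
      qed
      fix \<xi> :: "real^'d \<Rightarrow> real" assume \<xi>: "continuous_on UNIV \<xi>"
      define q where "q z = \<xi> (point_part z) * g z" for z
      have q: "continuous_on UNIV q"
        unfolding q_def
        by (intro continuous_intros g continuous_on_compose2[OF \<xi>] continuous_on_point_part) auto
      have qx: "q (u x) * density_part (u x) = \<xi> x * (g (u x) * density_part (u x))"
        if "u = v \<or> u = w" "x \<in> S" for u x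
      proof -
        have "extended_input S u" using that v w by auto
        then have "u x = 0 \<or> point_part (u x) = x" using that by (auto simp: extended_input_def)
        then show ?thesis by (auto simp: q_def density_part_def)
      qed
      have "(LINT x|lebesgue_on S. \<xi> x * ?f x) =
          (LINT x|lebesgue_on S. q (v x) * density_part (v x) - q (w x) * density_part (w x))"
        by (intro Bochner_Integration.integral_cong) (auto simp: qx right_diff_distrib)
      also have "\<dots> = J v q - J w q"
        unfolding J_def using int[OF _ q] by simp
      also have "\<dots> = 0" using all[OF q] by simp
      finally show "(LINT x|lebesgue_on S. \<xi> x * ?f x) = 0" .
    qed
    then show ?thesis by simp
  qed
  have "AE x in lebesgue_on S. \<forall>i\<in>UNIV. v x $ i * density_part (v x) = w x $ i * density_part (w x)"
    by (rule AE_finite_allI) (auto intro!: wt continuous_intros)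
  moreover have "AE x in lebesgue_on S. 1 * density_part (v x) = 1 * density_part (w x)"
    by (rule wt) simp
  moreover have "AE x in lebesgue_on S. x \<in> S" by (rule AE_I2) simp
  ultimately show ?thesis
  proof eventually_elim
    case (elim x)
    have "v x = 0 \<or> 0 < density_part (v x)" "w x = 0 \<or> 0 < density_part (w x)"
      using v(3) w(3) elim by (auto simp: extended_input_def)
    with elim show ?case by (auto simp: vec_eq_iff density_part_def)
  qed
qed

section \<open>Realization by a point cloud neural operator\<close>

text \<open>
  The relation \<open>T X S \<rho> v\<close> says that the domain \<open>S\<close> with density \<open>\<rho>\<close> and input \<open>v\<close> belongs to the abstract
  point \<open>X\<close>. It is a relation and not a function since an \<open>L\<^sub>p\<close> class may arise from several data, on all
  of which one and the same operator has to work.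

  An inner function \<open>t\<close> splits into a functional part \<open>\<integral> h\<^sub>1(v) \<rho>\<close> and a local part \<open>h\<^sub>2(v(x))\<close>,
  where \<open>h\<^sub>1\<close> and \<open>h\<^sub>2\<close> are shallow networks; a coordinate of \<open>x\<close> is itself a network in \<open>v(x)\<close>. The neurons
  of all \<open>h\<^sub>1\<close> and \<open>h\<^sub>2\<close> form the lifting layer. Their coefficients are the weights \<open>W\<^sup>v\<^sub>0\<close> and \<open>W\<^sup>l\<close> of
  the integral layer, and its activation is the outer one.
\<close>

theorem pcno_realization:
  fixes T :: "'x \<Rightarrow> (real^'d) set \<Rightarrow> (real^'d \<Rightarrow> real) \<Rightarrow> (real^'d \<Rightarrow> real^('a::finite + 'd::finite + unit)) \<Rightarrow> bool"
    and I :: "(real^('a::finite + 'd::finite + unit) \<Rightarrow> real) \<Rightarrow> 'x \<Rightarrow> real"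
    and g :: "'u::finite \<Rightarrow> 'x \<times> (real^'d) \<Rightarrow> real"
  defines "A \<equiv> {\<lambda>(X, x). I h X |h. h \<in> gelu_neurons} \<union> {\<lambda>(X, x). x $ s |s. True}"
  assumes T_int: "\<And>X S \<rho> v h. T X S \<rho> v \<Longrightarrow> h \<in> gelu_neurons \<Longrightarrow>
      integrable (lebesgue_on S) (\<lambda>y. h (v y) * \<rho> y) \<and> I h X = (LINT y|lebesgue_on S. h (v y) * \<rho> y)"
    and T_pt: "\<And>X S \<rho> v x. T X S \<rho> v \<Longrightarrow> x \<in> S \<Longrightarrow> point_part (v x) = x"
    and g: "\<And>r. g r \<in> lin_comb {\<lambda>z. gelu (t z + d) |t d. t \<in> lin_comb A}"
  obtains \<theta> :: "('a::finite + 'd::finite + unit, 'd, 'u::finite) pcno" where "pcno_ok \<theta>"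
    "\<And>X S \<rho> v. T X S \<rho> v \<Longrightarrow> pcno_defined \<theta> S \<rho> v"
    "\<And>X S \<rho> v x. T X S \<rho> v \<Longrightarrow> x \<in> S \<Longrightarrow> pcno_map \<theta> S \<rho> v x = (\<chi> r. g r (X, x))"
proof -
  define rep where "rep t h1 h2 \<longleftrightarrow> h1 \<in> lin_comb gelu_neurons \<and> h2 \<in> lin_comb gelu_neurons \<and>
    (\<forall>X S \<rho> v. T X S \<rho> v \<longrightarrow> integrable (lebesgue_on S) (\<lambda>y. h1 (v y) * \<rho> y) \<and>
      (\<forall>x\<in>S. t (X, x) = (LINT y|lebesgue_on S. h1 (v y) * \<rho> y) + h2 (v x)))" for t h1 h2
  have rep: "\<exists>h1 h2. rep t h1 h2" if "t \<in> lin_comb A" for t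
    using that
  proof induction
    case zero
    show ?case
      by (intro exI[of _ "\<lambda>z. 0"]) (simp add: rep_def lin_comb.zero)
  next
    case (step g f c)
    then obtain f1 f2 where f: "rep f f1 f2" by blast
    from step.hyps(1) consider h where "h \<in> gelu_neurons" "g = (\<lambda>(X, x). I h X)"
      | s where "g = (\<lambda>(X, x). x $ s)"
      by (auto simp: A_def)
    then show ?case
    proof cases
      case 1
      have "rep (\<lambda>x. c * g x + f x) (\<lambda>z. c * h z + f1 z) f2"
        unfolding rep_def
      proof (intro conjI allI impI)
        show "(\<lambda>z. c * h z + f1 z) \<in> lin_comb gelu_neurons" "f2 \<in> lin_comb gelu_neurons"
          using f 1(1) by (auto simp: rep_def intro: lin_comb.step)
        fix X S \<rho> v assume T: "T X S \<rho> v"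
        have i: "integrable (lebesgue_on S) (\<lambda>y. h (v y) * \<rho> y)" "integrable (lebesgue_on S) (\<lambda>y. f1 (v y) * \<rho> y)"
          using T_int[OF T 1(1)] f T by (auto simp: rep_def)
        have eq: "(\<lambda>y. (c * h (v y) + f1 (v y)) * \<rho> y) = (\<lambda>y. c * (h (v y) * \<rho> y) + f1 (v y) * \<rho> y)"
          by (simp add: algebra_simps)
        show "integrable (lebesgue_on S) (\<lambda>y. (c * h (v y) + f1 (v y)) * \<rho> y)"
          unfolding eq using i by simp
        show "\<forall>x\<in>S. c * g (X, x) + f (X, x) =
            (LINT y|lebesgue_on S. (c * h (v y) + f1 (v y)) * \<rho> y) + f2 (v x)"
          unfolding eq using i f T T_int[OF T 1(1)] by (auto simp: rep_def 1(2))
      qed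
      then show ?thesis by blast
    next
      case 2
      have "rep (\<lambda>x. c * g x + f x) f1 (\<lambda>z. c * z $ Inr (Inl s) + f2 z)"
        unfolding rep_def
      proof (intro conjI allI impI)
        show "(\<lambda>z. c * z $ Inr (Inl s) + f2 z) \<in> lin_comb gelu_neurons" "f1 \<in> lin_comb gelu_neurons"
          using f by (auto simp: rep_def intro!: lin_comb_add lin_comb_scale coordinate_in_gelu_network)
        fix X S \<rho> v assume T: "T X S \<rho> v"
        show "integrable (lebesgue_on S) (\<lambda>y. f1 (v y) * \<rho> y)"
          using f T by (auto simp: rep_def)
        have "v x $ Inr (Inl s) = x $ s" if "x \<in> S" for x
          using T_pt[OF T that] by (auto simp: point_part_def vec_eq_iff)
        then show "\<forall>x\<in>S. c * g (X, x) + f (X, x) =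
            (LINT y|lebesgue_on S. f1 (v y) * \<rho> y) + (c * v x $ Inr (Inl s) + f2 (v x))"
          using f T by (auto simp: rep_def 2)
      qed
      then show ?thesis by blast
    qed
  qed
  let ?N = "{\<lambda>z. gelu (t z + d) |t d. t \<in> lin_comb A}"
  have ne: "?N \<noteq> {}" using lin_comb.zero by blast
  obtain N :: nat and G c
    where "0 < N \<and> (\<forall>i<N. G i \<in> ?N) \<and> (\<forall>r\<in>UNIV. g r = (\<lambda>z. \<Sum>i<N. c r i * G i z))"
    using lin_comb_common_representation[of UNIV _ g, OF finite ne g] by (elim exE)
  then have N: "0 < N" and G: "\<And>i. i < N \<Longrightarrow> G i \<in> ?N"
    and gc: "\<And>r. g r = (\<lambda>z. \<Sum>i<N. c r i * G i z)"
    by blast+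
  have "\<forall>i\<in>{..<N}. \<exists>h1 h2 d t. rep t h1 h2 \<and> G i = (\<lambda>z. gelu (t z + d))"
  proof
    fix i assume "i \<in> {..<N}"
    then obtain t d where "G i = (\<lambda>z. gelu (t z + d))" "t \<in> lin_comb A" using G by blast
    then show "\<exists>h1 h2 d t. rep t h1 h2 \<and> G i = (\<lambda>z. gelu (t z + d))" using rep by blast
  qed
  then obtain h1 where "\<forall>i\<in>{..<N}. \<exists>h2 d t. rep t (h1 i) h2 \<and> G i = (\<lambda>z. gelu (t z + d))"
    by (rule bchoice[THEN exE])
  then obtain h2 where "\<forall>i\<in>{..<N}. \<exists>d t. rep t (h1 i) (h2 i) \<and> G i = (\<lambda>z. gelu (t z + d))"
    by (rule bchoice[THEN exE])
  then obtain d where "\<forall>i\<in>{..<N}. \<exists>t. rep t (h1 i) (h2 i) \<and> G i = (\<lambda>z. gelu (t z + d i))"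
    by (rule bchoice[THEN exE])
  then obtain t where t: "\<forall>i\<in>{..<N}. rep (t i) (h1 i) (h2 i) \<and> G i = (\<lambda>z. gelu (t i z + d i))"
    by (rule bchoice[THEN exE])
  \<comment> \<open>Both families are indexed together, to get one common list of neurons.\<close>
  define h where "h k = (if fst k then h1 (snd k) else h2 (snd k))" for k :: "bool \<times> nat"
  have h_net: "h k \<in> lin_comb gelu_neurons" if "k \<in> UNIV \<times> {..<N}" for k
    using that t by (auto simp: h_def rep_def)
  have ne: "gelu_neurons \<noteq> ({} :: (real^('a::finite + 'd::finite + unit) \<Rightarrow> real) set)"
    by (auto simp: gelu_neurons_def)
  have fin: "finite ((UNIV :: bool set) \<times> {..<N})" by simp
  have "\<exists>(M :: nat) q \<kappa>. 0 < M \<and> (\<forall>j<M. q j \<in> gelu_neurons) \<and>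
      (\<forall>k\<in>UNIV \<times> {..<N}. h k = (\<lambda>z. \<Sum>j<M. \<kappa> k j * q j z))"
    by (rule lin_comb_common_representation[OF fin ne h_net])
  then obtain M :: nat and q \<kappa>
    where "0 < M \<and> (\<forall>j<M. q j \<in> gelu_neurons) \<and>
      (\<forall>k\<in>UNIV \<times> {..<N}. h k = (\<lambda>z. \<Sum>j<M. \<kappa> k j * q j z))"
    by (elim exE)
  then have M: "0 < M" and q: "\<And>j. j < M \<Longrightarrow> q j \<in> gelu_neurons"
    and h\<kappa>: "\<And>k. k \<in> UNIV \<times> {..<N} \<Longrightarrow> h k = (\<lambda>z. \<Sum>j<M. \<kappa> k j * q j z)"
    by blast+
  have "\<forall>j\<in>{..<M}. \<exists>\<omega> b. q j = (\<lambda>z. gelu (\<omega> \<bullet> z + b))"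
    using q by (auto simp: gelu_neurons_def)
  then obtain \<omega> where "\<forall>j\<in>{..<M}. \<exists>b. q j = (\<lambda>z. gelu (\<omega> j \<bullet> z + b))"
    by (rule bchoice[THEN exE])
  then obtain b where qb: "\<forall>j\<in>{..<M}. q j = (\<lambda>z. gelu (\<omega> j \<bullet> z + b j))"
    by (rule bchoice[THEN exE])
  define l :: "'d pcno_layer" where
    "l = \<lparr>in_width = M, out_width = N, lin_wt = (\<lambda>i j. \<kappa> (False, i) j), bias = d,
          lengths = (\<chi> s. 1), int_wt = (\<lambda>k i j. complex_of_real (\<kappa> (True, i) j)),
          grad_wt = (\<lambda>i j s. 0)\<rparr>"
  \<comment> \<open>The projection layer has two neurons per channel, with inputs of opposite sign, whose
    difference is the channel itself.\<close>
  define \<theta> :: "('a::finite + 'd::finite + unit, 'd, 'u::finite) pcno" where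
    "\<theta> = \<lparr>lift_width = M, lift_wt = (\<lambda>j i. \<omega> j $ i), lift_bias = b, freqs = {0}, layers = [l],
          proj_in_width = N, proj_width = N + N,
          proj_wt = (\<lambda>i j. if i < N then of_bool (i = j) else - of_bool (i - N = j)),
          proj_bias = (\<lambda>i. 0), out_wt = (\<lambda>r i. if i < N then c r i else - c r (i - N)), out_bias = 0\<rparr>"
  have l: "in_width l = M" "out_width l = N" "lin_wt l = (\<lambda>i j. \<kappa> (False, i) j)" "bias l = d"
    "int_wt l = (\<lambda>k i j. complex_of_real (\<kappa> (True, i) j))" "grad_wt l = (\<lambda>i j s. 0)"
    by (simp_all add: l_def)
  have \<theta>: "freqs \<theta> = {0}" "layers \<theta> = [l]"
    by (simp_all add: \<theta>_def)
  have lift: "lift_map \<theta> v y j = q j (v y)" if "j < M" for v :: "real^'d \<Rightarrow> real^('a::finite + 'd::finite + unit)" and y j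
    using that qb by (simp add: lift_map_def \<theta>_def inner_vec_def)
  have kernel: "int_kernel_term l 0 (lift_map \<theta> v) \<rho> x i = (\<lambda>y. complex_of_real (h1 i (v y) * \<rho> y))"
    if "i < N" for v :: "real^'d \<Rightarrow> real^('a::finite + 'd::finite + unit)" and \<rho> x i
  proof
    fix y
    have "(\<Sum>j<M. \<kappa> (True, i) j * q j (v y)) = h1 i (v y)"
      using h\<kappa>[of "(True, i)"] that by (simp add: h_def)
    moreover have "int_kernel_term l 0 (lift_map \<theta> v) \<rho> x i y =
        complex_of_real ((\<Sum>j<M. \<kappa> (True, i) j * q j (v y)) * \<rho> y)"
      by (simp add: int_kernel_term_def l lift)
    ultimately show "int_kernel_term l 0 (lift_map \<theta> v) \<rho> x i y = complex_of_real (h1 i (v y) * \<rho> y)"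
      by simp
  qed
  show ?thesis
  proof (rule that)
    show "pcno_ok \<theta>"
      using M N by (simp add: pcno_ok_def \<theta>_def l_def layer_ok_def)
    fix X S \<rho> v assume T: "T X S \<rho> v"
    have int: "integrable (lebesgue_on S) (int_kernel_term l 0 (lift_map \<theta> v) \<rho> x i)"
      if i: "i < N" for x i
      unfolding kernel[OF i] using i t T by (intro integrable_of_real) (auto simp: rep_def)
    show "pcno_defined \<theta> S \<rho> v"
      using int by (simp add: pcno_defined_def \<theta> layer_defined_def l)
    fix x assume x: "x \<in> S"
    have layer: "layer_map {0} S \<rho> l (lift_map \<theta> v) x i = G i (X, x)" if i: "i < N" for i
    proof -
      have "(\<Sum>j<M. \<kappa> (False, i) j * q j (v x)) = h2 i (v x)"
        using h\<kappa>[of "(False, i)"] i by (simp add: h_def)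
      then have "layer_map {0} S \<rho> l (lift_map \<theta> v) x i =
          gelu (h2 i (v x) + d i + (LINT y|lebesgue_on S. h1 i (v y) * \<rho> y))"
        by (simp add: layer_map_def l lift kernel[OF i] del: of_real_mult)
      also have "h2 i (v x) + (LINT y|lebesgue_on S. h1 i (v y) * \<rho> y) = t i (X, x)"
        using t T x i by (auto simp: rep_def)
      then have "h2 i (v x) + d i + (LINT y|lebesgue_on S. h1 i (v y) * \<rho> y) = t i (X, x) + d i"
        by simp
      finally show ?thesis using t i by simp
    qed
    have "pcno_map \<theta> S \<rho> v x $ r = g r (X, x)" for r
    proof -
      define f where "f = layer_map {0} S \<rho> l (lift_map \<theta> v)"
      have "pcno_map \<theta> S \<rho> v = proj_map \<theta> f"
        by (simp add: pcno_map_def f_def \<theta>)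
      then have "pcno_map \<theta> S \<rho> v x $ r = (\<Sum>i<N + N. (if i < N then c r i else - c r (i - N)) *
          gelu (\<Sum>j<N. (if i < N then of_bool (i = j) else - of_bool (i - N = j)) * f x j))"
        by (simp add: proj_map_def \<theta>_def)
      also have "\<dots> = (\<Sum>i<N. c r i * gelu (f x i)) + (\<Sum>i<N. - c r i * gelu (- f x i))"
        by (simp add: sum_lessThan_add sum_negf if_distrib[of "\<lambda>a. a * _"] of_bool_def cong: if_cong)
      also have "\<dots> = (\<Sum>i<N. c r i * (gelu (f x i) - gelu (- f x i)))"
        by (simp add: sum.distrib[symmetric] algebra_simps)
      also have "\<dots> = (\<Sum>i<N. c r i * G i (X, x))"
        using layer by (simp add: gelu_diff f_def)
      finally show ?thesis by (simp add: gc)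
    qed
    then show "pcno_map \<theta> S \<rho> v x = (\<chi> r. g r (X, x))"
      by (simp add: vec_eq_iff)
  qed
qed

section \<open>The approximation theorem\<close>

theorem theorem3:
  fixes p :: real
    and D :: "((real^'d \<Rightarrow> real^'a) \<times> (real^'d) set) set"
    and G :: "(real^'d \<Rightarrow> real^'a) \<times> (real^'d) set \<Rightarrow> real^'d \<Rightarrow> real^'u"
    and \<rho> :: "(real^'d) set \<Rightarrow> real^'d \<Rightarrow> real"
    and B :: "(real^'d) set" and c :: "real^'d" and s :: real
    and K\<^sub>B :: "(real^'d \<Rightarrow> real^('a + 'd + unit)) set set"
    and G\<^sub>B :: "(real^'d \<Rightarrow> real^('a + 'd + unit)) set \<Rightarrow> (real^'d \<Rightarrow> real^'u) set"
  assumes "1 \<le> p"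
    and "bounded (\<Union>(a, \<Omega>)\<in>D. \<Omega>)"
    and "\<And>a \<Omega>. (a, \<Omega>) \<in> D \<Longrightarrow> interior \<Omega> \<noteq> {} \<and> lipschitz_boundary \<Omega>"
    and "\<And>a \<Omega>. (a, \<Omega>) \<in> D \<Longrightarrow> a \<in> Lp_fun p \<Omega> \<and> G (a, \<Omega>) \<in> Lp_fun p \<Omega>"
    and "\<And>a \<Omega>. (a, \<Omega>) \<in> D \<Longrightarrow> density_on \<Omega> (\<rho> \<Omega>)"
    and "0 < (INF (a, \<Omega>)\<in>D. INF x\<in>\<Omega>. ereal (\<rho> \<Omega> x))"
    and "0 < s" and "B = cbox c (c + (\<chi> i. s))"
    and "\<And>a \<Omega>. (a, \<Omega>) \<in> D \<Longrightarrow> \<Omega> \<subseteq> B"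
    and "K\<^sub>B \<subseteq> {Lp_class p B (zero_ext \<Omega> (tilde_input a (\<rho> \<Omega>))) | a \<Omega>. (a, \<Omega>) \<in> D}"
    and "compactin (Lp_topology p B) K\<^sub>B"
    and "continuous_map (subtopology (Lp_topology p B) K\<^sub>B) (Lp_topology p B) G\<^sub>B"
    and "\<And>a \<Omega>. (a, \<Omega>) \<in> D \<Longrightarrow> Lp_class p B (zero_ext \<Omega> (tilde_input a (\<rho> \<Omega>))) \<in> K\<^sub>B \<Longrightarrow>
           G\<^sub>B (Lp_class p B (zero_ext \<Omega> (tilde_input a (\<rho> \<Omega>)))) =
             Lp_class p B (zero_ext \<Omega> (G (a, \<Omega>)))"
    and "(SUP (a, \<Omega>)\<in>{(a, \<Omega>)\<in>D. Lp_class p B (zero_ext \<Omega> (tilde_input a (\<rho> \<Omega>))) \<in> K\<^sub>B}.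
            esssup (lebesgue_on B) (\<lambda>x. ereal (norm (zero_ext \<Omega> (tilde_input a (\<rho> \<Omega>)) x)))) < \<infinity>"
  shows "\<forall>\<epsilon>>0. \<exists>\<theta> :: ('a + 'd + unit, 'd, 'u) pcno. pcno_ok \<theta> \<and>
           (\<forall>(a, \<Omega>)\<in>D. Lp_class p B (zero_ext \<Omega> (tilde_input a (\<rho> \<Omega>))) \<in> K\<^sub>B \<longrightarrow>
              pcno_defined \<theta> \<Omega> (\<rho> \<Omega>) (tilde_input a (\<rho> \<Omega>)) \<and>
              pcno_map \<theta> \<Omega> (\<rho> \<Omega>) (tilde_input a (\<rho> \<Omega>)) \<in> Lp_fun p \<Omega> \<and>
              Lp_norm p \<Omega> (\<lambda>x. G (a, \<Omega>) x - pcno_map \<theta> \<Omega> (\<rho> \<Omega>) (tilde_input a (\<rho> \<Omega>)) x) \<le> \<epsilon>)"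
proof (intro allI impI)
  fix \<epsilon> :: real assume \<epsilon>: "\<epsilon> > 0"
  note p = assms(1)
  have B: "B \<in> lmeasurable" "B \<in> sets lebesgue" "compact B"
    using assms(8) by auto
  \<comment> \<open>\<open>R\<close> collects the data whose extended inputs belong to the compact set.\<close>
  define ext where "ext a \<Omega> = zero_ext \<Omega> (tilde_input a (\<rho> \<Omega>))" for a :: "real^'d \<Rightarrow> real^'a" and \<Omega>
  define R where "R = {(a, \<Omega>) \<in> D. Lp_class p B (ext a \<Omega>) \<in> K\<^sub>B}"
  define V where "V = {ext a \<Omega> |a \<Omega>. (a, \<Omega>) \<in> R}"
  have RD: "(a, \<Omega>) \<in> D" "Lp_class p B (ext a \<Omega>) \<in> K\<^sub>B" if "(a, \<Omega>) \<in> R" for a \<Omega>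
    using that by (auto simp: R_def)
  have VI: "ext a \<Omega> \<in> V" if "(a, \<Omega>) \<in> R" for a \<Omega>
    using that unfolding V_def by blast
  have KV: "K\<^sub>B = Lp_class p B ` V"
  proof (intro equalityI subsetI)
    fix Y assume Y: "Y \<in> K\<^sub>B"
    then obtain a \<Omega> where "(a, \<Omega>) \<in> D" "Y = Lp_class p B (ext a \<Omega>)"
      using assms(10) by (auto simp: ext_def)
    with Y have "(a, \<Omega>) \<in> R" "Y = Lp_class p B (ext a \<Omega>)" by (auto simp: R_def)
    then show "Y \<in> Lp_class p B ` V" unfolding V_def by blast
  qed (auto simp: V_def R_def)
  interpret Lin: Metric_space "Lp_space p B :: (real^'d \<Rightarrow> real^('a + 'd + unit)) set set" "Lp_dist p B"
    by (rule Metric_space_Lp[OF p])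
  interpret Lout: Metric_space "Lp_space p B :: (real^'d \<Rightarrow> real^'u) set set" "Lp_dist p B"
    by (rule Metric_space_Lp[OF p])
  have KL: "K\<^sub>B \<subseteq> Lp_space p B"
    using compactin_subset_topspace[OF assms(11)] by (simp add: Lp_topology_def)
  have V_Lp: "V \<subseteq> Lp_fun p B"
  proof
    fix v assume "v \<in> V"
    then have "Lp_class p B v \<in> Lp_space p B" using KV KL by auto
    then show "v \<in> Lp_fun p B" by (rule Lp_fun_if_class_in_space[OF B(2)])
  qed
  have V_meas: "v \<in> borel_measurable (lebesgue_on B)" if "v \<in> V" for v
    using that V_Lp by (auto intro: Lp_fun_measurable)
  obtain M :: real where M: "\<And>v. v \<in> V \<Longrightarrow> AE x in lebesgue_on B. norm (v x) \<le> M"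
  proof -
    define s\<^sub>V where "s\<^sub>V = (SUP (a, \<Omega>)\<in>R. esssup (lebesgue_on B) (\<lambda>x. ereal (norm (ext a \<Omega> x))))"
    have "s\<^sub>V < \<infinity>" using assms(14) unfolding s\<^sub>V_def R_def ext_def .
    then obtain M where M: "s\<^sub>V \<le> ereal M" by (metis ereal_less_eq(1) less_ereal.simps(2) less_le_not_le ereal_dense2 less_imp_le)
    show ?thesis
    proof (rule that)
      fix v assume "v \<in> V"
      then obtain a \<Omega> where v: "v = ext a \<Omega>" "(a, \<Omega>) \<in> R" by (auto simp: V_def)
      have "esssup (lebesgue_on B) (\<lambda>x. ereal (norm (v x))) \<le> s\<^sub>V"
        unfolding s\<^sub>V_def v(1) by (rule SUP_upper2[OF v(2)]) simp
      then have le: "esssup (lebesgue_on B) (\<lambda>x. ereal (norm (v x))) \<le> ereal M" using M by (rule order_trans)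
      from esssup_AE[of "\<lambda>x. ereal (norm (v x))" "lebesgue_on B"]
      show "AE x in lebesgue_on B. norm (v x) \<le> M"
      proof eventually_elim
        case (elim x)
        from order_trans[OF elim le] show ?case by simp
      qed
    qed
  qed
  have \<rho>_pos: "0 < \<rho> \<Omega> x" if "(a, \<Omega>) \<in> D" "x \<in> \<Omega>" for a \<Omega> x
  proof -
    have "(INF (a, \<Omega>)\<in>D. INF x\<in>\<Omega>. ereal (\<rho> \<Omega> x)) \<le> ereal (\<rho> \<Omega> x)"
      by (rule INF_lower2[OF that(1)]) (auto intro: INF_lower that(2))
    with assms(6) have "0 < ereal (\<rho> \<Omega> x)" by (rule less_le_trans)
    then show ?thesis by simp
  qed
  have parts: "point_part (tilde_input a (\<rho> \<Omega>) x) = x" "density_part (tilde_input a (\<rho> \<Omega>) x) = \<rho> \<Omega> x" for a \<Omega> x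
    by (simp_all add: point_part_def density_part_def tilde_input_def vec_eq_iff)
  have V_ext: "extended_input B v" if "v \<in> V" for v
    using that by (auto simp: V_def extended_input_def ext_def zero_ext_def parts intro: \<rho>_pos[OF RD(1)])
  \<comment> \<open>The domain is recovered from the measurable extended input, as the set where its density is positive.\<close>
  have \<Omega>_meas: "\<Omega> \<in> sets lebesgue" if "(a, \<Omega>) \<in> R" for a \<Omega>
  proof -
    have "ext a \<Omega> \<in> borel_measurable (lebesgue_on B)" by (rule V_meas[OF VI[OF that]])
    then have "(\<lambda>x. density_part (ext a \<Omega> x)) \<in> borel_measurable (lebesgue_on B)"
      by (rule borel_measurable_continuous_compose[OF continuous_on_density_part])
    then have "{x \<in> space (lebesgue_on B). 0 < density_part (ext a \<Omega> x)} \<in> sets (lebesgue_on B)"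
      by (rule borel_measurable_less[OF borel_measurable_const])
    also have "{x \<in> space (lebesgue_on B). 0 < density_part (ext a \<Omega> x)} = \<Omega>"
    proof (intro equalityI subsetI)
      fix x assume "x \<in> {x \<in> space (lebesgue_on B). 0 < density_part (ext a \<Omega> x)}"
      then show "x \<in> \<Omega>" by (auto simp: ext_def zero_ext_def density_part_def split: if_splits)
    next
      fix x assume x: "x \<in> \<Omega>"
      then show "x \<in> {x \<in> space (lebesgue_on B). 0 < density_part (ext a \<Omega> x)}"
        using assms(9)[OF RD(1)[OF that]] \<rho>_pos[OF RD(1)[OF that] x]
        by (auto simp: ext_def zero_ext_def parts)
    qed
    finally show ?thesis using B(2) by (auto simp: sets_restrict_space)
  qed
  define TK where "TK = subtopology (Lp_topology p B) K\<^sub>B"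
  define X where "X = prod_topology TK (top_of_set B)"
  have TK: "compact_space TK" "topspace TK = K\<^sub>B"
    using assms(11) compactin_subset_topspace[OF assms(11)]
    by (auto simp: TK_def compact_space_subtopology)
  have X: "compact_space X" "topspace X = K\<^sub>B \<times> B"
    using TK B(3) by (auto simp: X_def compact_space_prod_topology compact_space_subtopology)
  define I where "I h = superposition_integral B (\<lambda>z. h z * density_part z)"
    for h :: "real^('a + 'd + unit) \<Rightarrow> real"
  have hd: "continuous_on UNIV (\<lambda>z. h z * density_part z)" if "h \<in> gelu_neurons" for h :: "real^('a + 'd + unit) \<Rightarrow> real"
    by (intro continuous_intros continuous_gelu_neurons[OF that] continuous_on_density_part)
  have I_class: "I h (Lp_class p B v) = (LINT x|lebesgue_on B. h (v x) * density_part (v x))"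
    if "h \<in> gelu_neurons" "v \<in> V" for h v
    unfolding I_def using superposition_integral_class[OF _ hd[OF that(1)]] that(2) V_Lp by auto
  define A where "A = {\<lambda>(Z :: (real^'d \<Rightarrow> real^('a + 'd + unit)) set, x :: real^'d). I h Z |h. h \<in> gelu_neurons}
      \<union> {\<lambda>(Z, x). x $ s |s. True}"
  have A_cont: "continuous_map X euclideanreal f" if "f \<in> A" for f
  proof -
    from that consider h where "h \<in> gelu_neurons" "f = (\<lambda>(X, x). I h X)" | s where "f = (\<lambda>(X, x). x $ s)"
      by (auto simp: A_def)
    then show ?thesis
    proof cases
      case 1
      have "continuous_map TK euclideanreal (I h)"
        unfolding I_def TK_def KV
        by (rule superposition_integral_continuous[OF p B(1) hd[OF 1(1)] V_Lp M])
      from continuous_map_compose[OF continuous_map_fst this] show ?thesis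
        by (simp add: X_def 1(2) o_def case_prod_unfold)
    next
      case 2
      have "continuous_map (top_of_set B) euclideanreal (\<lambda>x. x $ s)"
        by (simp add: continuous_on_component)
      from continuous_map_compose[OF continuous_map_snd this] show ?thesis
        by (simp add: X_def 2 o_def case_prod_unfold)
    qed
  qed
  have A_sep: "\<exists>f\<in>A. f x \<noteq> f y" if xy: "x \<in> topspace X" "y \<in> topspace X" "x \<noteq> y" for x y
  proof (rule ccontr)
    assume "\<not> ?thesis"
    then have eq: "f x = f y" if "f \<in> A" for f using that by blast
    obtain v w where v: "v \<in> V" "fst x = Lp_class p B v" and w: "w \<in> V" "fst y = Lp_class p B w"
      using xy(1,2) by (auto simp: X(2) KV)
    have "snd x $ i = snd y $ i" for i
      using eq[of "\<lambda>(X, x). x $ i"] by (auto simp: A_def case_prod_unfold)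
    then have snd: "snd x = snd y" by (simp add: vec_eq_iff)
    have "I h (fst x) = I h (fst y)" if "h \<in> gelu_neurons" for h
      using eq[of "\<lambda>(X, x). I h X"] that by (auto simp: A_def case_prod_unfold)
    then have "AE x in lebesgue_on B. v x = w x"
      using v w
      by (intro extended_input_determined[OF B(1) V_meas[OF v(1)] M[OF v(1)] V_ext[OF v(1)]
            V_meas[OF w(1)] M[OF w(1)] V_ext[OF w(1)]]) (simp add: I_class)
    then have "fst x = fst y" unfolding v(2) w(2) by (rule Lp_class_eqI)
    with snd xy(3) show False by (simp add: prod_eq_iff)
  qed
  have GB: "continuous_map TK (Lp_topology p B) G\<^sub>B" using assms(12) by (simp add: TK_def)
  obtain W cw where W: "finite W" "\<And>w. w \<in> W \<Longrightarrow> continuous_on UNIV w \<and> w \<in> Lp_fun p B"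
    and cw: "\<And>w. w \<in> W \<Longrightarrow> continuous_map TK euclideanreal (cw w)"
    and W_approx: "\<And>x u. x \<in> topspace TK \<Longrightarrow> u \<in> Lp_fun p B \<Longrightarrow> G\<^sub>B x = Lp_class p B u \<Longrightarrow>
       Lp_norm p B (\<lambda>y. u y - (\<Sum>w\<in>W. cw w x *\<^sub>R w y)) \<le> \<epsilon> / 2"
    using Lp_valued_map_approximation[OF p B(1) TK(1) GB half_gt_zero[OF \<epsilon>]] by blast
  define H where "H x y = (\<Sum>w\<in>W. cw w x *\<^sub>R w y)" for x y
  define m where "m = measure (lebesgue_on B) B powr (1 / p)"
  \<comment> \<open>An error below \<open>\<delta>\<close> in each of the output channels costs at most \<open>CARD('u) \<delta> m \<le> \<epsilon> / 2\<close> in \<open>L\<^sub>p\<close>.\<close>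
  define \<delta> where "\<delta> = \<epsilon> / 2 / (real CARD('u) * (m + 1))"
  have m: "m \<ge> 0" by (simp add: m_def)
  have \<delta>: "\<delta> > 0" using \<epsilon> m by (simp add: \<delta>_def)
  have \<delta>m: "real CARD('u) * \<delta> * m \<le> \<epsilon> / 2"
  proof -
    have "real CARD('u) * \<delta> * m = \<epsilon> / 2 * (m / (m + 1))" by (simp add: \<delta>_def)
    also have "\<dots> \<le> \<epsilon> / 2 * 1" using m \<epsilon> by (intro mult_left_mono) auto
    finally show ?thesis by simp
  qed
  have H_cont: "continuous_map X euclideanreal (\<lambda>z. H (fst z) (snd z) $ r)" for r
  proof -
    have "continuous_map X euclideanreal (\<lambda>z. cw w (fst z) * w (snd z) $ r)" if w: "w \<in> W" for w
    proof -
      have "continuous_map (top_of_set B) euclideanreal (\<lambda>y. w y $ r)"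
        using W(2)[OF w] by (auto intro!: continuous_intros intro: continuous_on_subset)
      from continuous_map_compose[OF continuous_map_snd this] continuous_map_compose[OF continuous_map_fst cw[OF w]]
      show ?thesis by (intro continuous_map_real_mult) (auto simp: X_def o_def)
    qed
    then show ?thesis
      unfolding H_def by (auto simp: sum_component intro!: continuous_map_sum W(1))
  qed
  have "\<forall>r. \<exists>g. g \<in> lin_comb {\<lambda>x. gelu (t x + d) |t d. t \<in> lin_comb A} \<and>
      (\<forall>x\<in>topspace X. \<bar>H (fst x) (snd x) $ r - g x\<bar> < \<delta>)"
    using gelu_ridge_dense[OF X(1) A_cont A_sep H_cont \<delta>] by blast
  then obtain g where "\<forall>r. g r \<in> lin_comb {\<lambda>x. gelu (t x + d) |t d. t \<in> lin_comb A} \<and>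
      (\<forall>x\<in>topspace X. \<bar>H (fst x) (snd x) $ r - g r x\<bar> < \<delta>)"
    by (rule choice[THEN exE])
  then have g: "\<And>r. g r \<in> lin_comb {\<lambda>x. gelu (t x + d) |t d. t \<in> lin_comb A}"
    "\<And>r x. x \<in> topspace X \<Longrightarrow> \<bar>H (fst x) (snd x) $ r - g r x\<bar> < \<delta>"
    by simp_all
  have g_cont: "continuous_map X euclideanreal (g r)" for r
  proof (rule continuous_map_lin_comb[OF g(1)], clarify)
    fix t d assume "t \<in> lin_comb A"
    then have "continuous_map X euclideanreal (\<lambda>x. t x + d)"
      using continuous_map_add[OF continuous_map_lin_comb[OF _ A_cont]] by simp
    from continuous_map_compose[OF this, of euclideanreal gelu]
    show "continuous_map X euclideanreal (\<lambda>x. gelu (t x + d))"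
      by (simp add: o_def continuous_on_gelu)
  qed
  define T where "T Z S r v \<longleftrightarrow> (\<exists>a \<Omega>. (a, \<Omega>) \<in> R \<and> Z = Lp_class p B (ext a \<Omega>) \<and> S = \<Omega> \<and> r = \<rho> \<Omega> \<and>
    v = tilde_input a (\<rho> \<Omega>))" for Z S r v
  obtain \<theta> :: "('a + 'd + unit, 'd, 'u) pcno" where \<theta>: "pcno_ok \<theta>"
    "\<And>X S \<rho> v. T X S \<rho> v \<Longrightarrow> pcno_defined \<theta> S \<rho> v"
    "\<And>X S \<rho> v x. T X S \<rho> v \<Longrightarrow> x \<in> S \<Longrightarrow> pcno_map \<theta> S \<rho> v x = (\<chi> r. g r (X, x))"
  proof (rule pcno_realization[of T I g])
    show "integrable (lebesgue_on S) (\<lambda>y. h (v y) * r y) \<and> I h X = (LINT y|lebesgue_on S. h (v y) * r y)"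
      if T: "T X S r v" and h: "h \<in> gelu_neurons" for X S r v h
    proof -
      obtain a \<Omega> where *: "(a, \<Omega>) \<in> R" "X = Lp_class p B (ext a \<Omega>)" "S = \<Omega>" "r = \<rho> \<Omega>" "v = tilde_input a (\<rho> \<Omega>)"
        using T by (auto simp: T_def)
      note extV = VI[OF *(1)]
      let ?F = "\<lambda>x. h (ext a \<Omega> x) * density_part (ext a \<Omega> x)"
      have F0: "?F x = 0" if "x \<in> B - \<Omega>" for x
        using that by (simp add: ext_def zero_ext_def density_part_def)
      note supp = lebesgue_on_support[OF \<Omega>_meas[OF *(1)] B(2) assms(9)[OF RD(1)[OF *(1)]] F0]
      have intB: "integrable (lebesgue_on B) ?F"
        by (rule integrable_continuous_compose[OF B(1) hd[OF h] V_meas[OF extV] M[OF extV]])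
      have F\<Omega>: "?F x = h (v x) * r x" if "x \<in> \<Omega>" for x
        using that by (simp add: ext_def zero_ext_def parts *)
      have "integrable (lebesgue_on \<Omega>) (\<lambda>y. h (v y) * r y) \<longleftrightarrow> integrable (lebesgue_on \<Omega>) ?F"
        "(LINT y|lebesgue_on \<Omega>. h (v y) * r y) = (LINT y|lebesgue_on \<Omega>. ?F y)"
        using F\<Omega> by (auto intro!: Bochner_Integration.integrable_cong Bochner_Integration.integral_cong)
      then show ?thesis
        using supp intB I_class[OF h extV] *(2,3) by simp
    qed
    show "point_part (v x) = x" if "T X S r v" "x \<in> S" for X S r v x
      using that by (auto simp: T_def parts)
    show "g r \<in> lin_comb {\<lambda>z. gelu (t z + d) |t d. t \<in> lin_comb ({\<lambda>(X, x). I h X |h. h \<in> gelu_neurons} \<union> {\<lambda>(X, x). x $ s |s. True})}" for r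
      using g(1)[of r] unfolding A_def .
  qed blast
  have main: "pcno_defined \<theta> \<Omega> (\<rho> \<Omega>) (tilde_input a (\<rho> \<Omega>)) \<and>
      pcno_map \<theta> \<Omega> (\<rho> \<Omega>) (tilde_input a (\<rho> \<Omega>)) \<in> Lp_fun p \<Omega> \<and>
      Lp_norm p \<Omega> (\<lambda>x. G (a, \<Omega>) x - pcno_map \<theta> \<Omega> (\<rho> \<Omega>) (tilde_input a (\<rho> \<Omega>)) x) \<le> \<epsilon>"
    if R: "(a, \<Omega>) \<in> R" for a \<Omega>
  proof -
    define Y where "Y = Lp_class p B (ext a \<Omega>)"
    have T: "T Y \<Omega> (\<rho> \<Omega>) (tilde_input a (\<rho> \<Omega>))" using R by (auto simp: T_def Y_def)
    have Y: "Y \<in> K\<^sub>B" using RD(2)[OF R] by (simp add: Y_def)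
    have sub: "\<Omega> \<subseteq> B" by (rule assms(9)[OF RD(1)[OF R]])
    define P where "P x = (\<chi> r. g r (Y, x))" for x
    have P: "pcno_map \<theta> \<Omega> (\<rho> \<Omega>) (tilde_input a (\<rho> \<Omega>)) x = P x" if "x \<in> \<Omega>" for x
      using \<theta>(3)[OF T that] by (simp add: P_def)
    have "continuous_map (top_of_set B) X (\<lambda>x. (Y, x))"
      using Y TK(2) by (simp add: X_def continuous_map_paired)
    then have "continuous_on B (\<lambda>x. g r (Y, x))" for r
      using continuous_map_compose[OF _ g_cont] by (fastforce simp: o_def)
    then have P_cont: "continuous_on B P" unfolding P_def by (intro continuous_on_vec_lambda)
    have P_meas: "P \<in> borel_measurable (lebesgue_on B)"
      by (rule continuous_imp_measurable_on_sets_lebesgue[OF P_cont B(2)])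
    have "bounded (P ` B)" by (intro compact_imp_bounded compact_continuous_image P_cont B(3))
    then obtain C where C: "\<forall>x\<in>B. norm (P x) \<le> C" unfolding bounded_iff by blast
    have P_Lp: "P \<in> Lp_fun p B"
      by (rule Lp_fun_bounded[OF B(1) P_meas _ p, of C]) (use C in \<open>auto intro: AE_I2\<close>)
    have H_Lp: "H Y \<in> Lp_fun p B"
      using Lp_norm_sum_le[OF p W(1), of "\<lambda>w. w" B "\<lambda>w. cw w Y"] W(2) by (auto simp: H_def[abs_def])
    define u where "u = zero_ext \<Omega> (G (a, \<Omega>))"
    have GY: "G\<^sub>B Y = Lp_class p B u"
      using assms(13)[OF RD(1)[OF R]] RD(2)[OF R] by (simp add: Y_def u_def ext_def)
    have "G\<^sub>B Y \<in> Lp_space p B"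
      using continuous_map_image_subset_topspace[OF GB] Y TK(2) by (auto simp: Lp_topology_def)
    then have u_Lp: "u \<in> Lp_fun p B"
      unfolding GY by (rule Lp_fun_if_class_in_space[OF B(2)])
    have 1: "Lp_norm p B (\<lambda>y. u y - H Y y) \<le> \<epsilon> / 2"
      using W_approx[OF _ u_Lp GY] Y TK(2) by (simp add: H_def)
    have "norm (H Y y - P y) \<le> real CARD('u) * \<delta>" if y: "y \<in> B" for y
    proof -
      have "norm (H Y y - P y) \<le> (\<Sum>r\<in>UNIV. \<bar>(H Y y - P y) $ r\<bar>)" by (rule norm_le_l1_cart)
      also have "\<dots> \<le> (\<Sum>r\<in>(UNIV :: 'u set). \<delta>)"
        using g(2)[of "(Y, y)"] X(2) Y y by (intro sum_mono) (auto simp: P_def intro: less_imp_le)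
      finally show ?thesis by simp
    qed
    then have "Lp_norm p B (\<lambda>y. H Y y - P y) \<le> real CARD('u) * \<delta> * m"
      unfolding m_def using \<delta> by (intro Lp_norm_bounded_le[OF p B(1)] Lp_fun_diff[OF p H_Lp P_Lp]) auto
    with \<delta>m have 2: "Lp_norm p B (\<lambda>y. H Y y - P y) \<le> \<epsilon> / 2" by linarith
    have tri: "norm (u y - P y) \<le> norm (u y - H Y y) + norm (H Y y - P y)" for y
      using norm_triangle_ineq[of "u y - H Y y" "H Y y - P y"] by simp
    have "Lp_norm p \<Omega> (\<lambda>x. G (a, \<Omega>) x - pcno_map \<theta> \<Omega> (\<rho> \<Omega>) (tilde_input a (\<rho> \<Omega>)) x)
        = Lp_norm p \<Omega> (\<lambda>x. u x - P x)"
      by (rule Lp_cong(2)) (simp add: P u_def zero_ext_def)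
    also have "\<dots> \<le> Lp_norm p B (\<lambda>x. u x - P x)"
      by (rule Lp_restrict(2)[OF \<Omega>_meas[OF R] B(2) sub p Lp_fun_diff[OF p u_Lp P_Lp]])
    also have "\<dots> \<le> Lp_norm p B (\<lambda>y. u y - H Y y) + Lp_norm p B (\<lambda>y. H Y y - P y)"
      by (rule Lp_norm_triangle[OF p Lp_fun_diff[OF p u_Lp H_Lp] Lp_fun_diff[OF p H_Lp P_Lp]
            Lp_fun_diff[OF p u_Lp P_Lp] tri])
    also have "\<dots> \<le> \<epsilon>" using 1 2 by linarith
    finally have "Lp_norm p \<Omega> (\<lambda>x. G (a, \<Omega>) x - pcno_map \<theta> \<Omega> (\<rho> \<Omega>) (tilde_input a (\<rho> \<Omega>)) x) \<le> \<epsilon>" .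
    moreover have "pcno_map \<theta> \<Omega> (\<rho> \<Omega>) (tilde_input a (\<rho> \<Omega>)) \<in> Lp_fun p \<Omega>"
      using Lp_cong(1)[of \<Omega> _ P, OF P] Lp_restrict(1)[OF \<Omega>_meas[OF R] B(2) sub p P_Lp] by blast
    ultimately show ?thesis using \<theta>(2)[OF T] by blast
  qed
  show "\<exists>\<theta> :: ('a + 'd + unit, 'd, 'u) pcno. pcno_ok \<theta> \<and>
           (\<forall>(a, \<Omega>)\<in>D. Lp_class p B (zero_ext \<Omega> (tilde_input a (\<rho> \<Omega>))) \<in> K\<^sub>B \<longrightarrow>
              pcno_defined \<theta> \<Omega> (\<rho> \<Omega>) (tilde_input a (\<rho> \<Omega>)) \<and>
              pcno_map \<theta> \<Omega> (\<rho> \<Omega>) (tilde_input a (\<rho> \<Omega>)) \<in> Lp_fun p \<Omega> \<and>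
              Lp_norm p \<Omega> (\<lambda>x. G (a, \<Omega>) x - pcno_map \<theta> \<Omega> (\<rho> \<Omega>) (tilde_input a (\<rho> \<Omega>)) x) \<le> \<epsilon>)"
    using main by (intro exI[of _ \<theta>] conjI \<theta>(1)) (auto simp: R_def ext_def)
qed

end
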